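(* Let $\mathcal A$ and $\mathfrak A$ be Banach algebras such that $\mathcal A$ is a Banach $\mathfrak A$-bimodule with compatible actions. If $\mathcal A\rtimes\mathfrak A$ is $(2n+1)$-weakly amenable for some $n\in\mathbb N\cup\{0\}$, then the following assertions hold. (i) $\mathfrak A$ is $(2n+1)$-weakly amenable. (ii) If the pair $(\mathcal A,\mathfrak A)$ has the property $(\mathbb H_{2n+1})$, then $\mathcal A$ is $(2n+1)$-weakly amenable.
   Context: The actions of $\mathfrak A$ on $\mathcal A$ are compatible if for all $a,b\in\mathcal A$ and $\beta\in\mathfrak A$: $\beta\cdot(ab)=(\beta\cdot a)b$, $(ab)\cdot\beta=a(b\cdot\beta)$, $a(\beta\cdot b)=(a\cdot\beta)b$. The amalgamated duplication $\mathcal A\rtimes\mathfrak A$ is $\mathcal A\times\mathfrak A$ with product $(a,\beta)(b,\gamma)=(ab+a\cdot\gamma+\beta\cdot b,\ \beta\gamma)$ and norm $\|(a,\beta)\|=\|a\|+\|\beta\|$. $\mathcal Y^{(k)}$ is the $k$-th dual of a Banach space $\mathcal Y$ ($\mathcal Y^{(0)}=\mathcal Y$). If $\mathcal X$ is a Banach $\mathcal C$-bimodule, its dual is one via $\langle f\cdot c,x\rangle=\langle f,c\cdot x\rangle$, $\langle c\cdot f,x\rangle=\langle f,x\cdot c\rangle$; iterating gives the bimodule structure on every $\mathcal X^{(k)}$. For $a\in\mathcal A$, $\beta\in\mathfrak A$ write: $a\vartriangle x$, $x\circ a$ for the left and right actions of $\mathcal A$ on $x\in\mathcal A^{(k)}$;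 $\beta\vartriangle y$, $y\circ\beta$ for the left and right actions of $\mathfrak A$ on $y\in\mathfrak A^{(k)}$; $\beta\blacktriangle x$, $x\bullet\beta$ for the left and right actions of $\mathfrak A$ on $x\in\mathcal A^{(k)}$ (all induced by iterated dualization). Mixed operations: for $y\in\mathfrak A^{(2m)}$ the elements $a\blacktriangle y,\ y\bullet a\in\mathcal A^{(2m)}$ and for $x\in\mathcal A^{(2m+1)}$ the elements $a\blacktriangle x,\ x\bullet a\in\mathfrak A^{(2m+1)}$ are defined recursively by: for $m=0$, $a\blacktriangle y=a\cdot y$ and $y\bullet a=y\cdot a$; $\langle a\blacktriangle x,y\rangle=\langle x,y\bullet a\rangle$ and $\langle x\bullet a,y\rangle=\langle x,a\blacktriangle y\rangle$ for $x\in\mathcal A^{(2m+1)}$, $y\in\mathfrak A^{(2m)}$; $\langle a\blacktriangle y,x\rangle=\langle y,x\bullet a\rangle$ and $\langle y\bullet a,x\rangle=\langle y,a\blacktriangle x\rangle$ for $y\in\mathfrak A^{(2m+2)}$, $x\in\mathcal A^{(2m+1)}$. A derivation $D:\mathcal C\to\mathcal X$ is a continuous linear map with $D(c_1c_2)=D(c_1)\cdot c_2+c_1\cdot D(c_2)$; it is inner if $D(c)=c\cdot x-x\cdot c$ for some $x\in\mathcal X$. $\mathcal C$ is $k$-weakly amenable if every derivation $\mathcal C\to\mathcal C^{(k)}$ is inner. The pair $(\mathcal A,\mathfrak A)$ has the property $(\mathbb H_{2n+1})$ if for each derivation $D^1_{\mathcal A}:\mathcal A\to\mathcal A^{(2n+1)}$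 there are a derivation $D^1_{\mathfrak A}:\mathfrak A\to\mathcal A^{(2n+1)}$ and a bounded linear map $D^2_{\mathcal A}:\mathcal A\to\mathfrak A^{(2n+1)}$ such that for all $a,b\in\mathcal A$, $\beta\in\mathfrak A$: $D^1_{\mathcal A}(\beta\cdot a)=D^1_{\mathfrak A}(\beta)\circ a+\beta\blacktriangle D^1_{\mathcal A}(a)$; $D^1_{\mathcal A}(a\cdot\beta)=a\vartriangle D^1_{\mathfrak A}(\beta)+D^1_{\mathcal A}(a)\bullet\beta$; $D^2_{\mathcal A}(\beta\cdot a)=D^1_{\mathfrak A}(\beta)\bullet a+\beta\vartriangle D^2_{\mathcal A}(a)$; $D^2_{\mathcal A}(a\cdot\beta)=a\blacktriangle D^1_{\mathfrak A}(\beta)+D^2_{\mathcal A}(a)\circ\beta$; $D^2_{\mathcal A}(ab)=D^1_{\mathcal A}(a)\bullet b+a\blacktriangle D^1_{\mathcal A}(b)$. *)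

theory Defs
  imports "HOL-Analysis.Analysis"
begin

text \<open>
  The scalar field is a type \<^typ>\<open>'k::real_normed_field\<close>. By the theorems of Gelfand-Mazur and
  Ostrowski such a field is isometrically \<open>\<real>\<close> or \<open>\<complex>\<close>, so real and complex Banach algebras
  are both covered. Since the library has type classes for real scalars only, a normed
  space over \<^typ>\<open>'k\<close> is a real normed space with a compatible multiplication by \<^typ>\<open>'k\<close>.
\<close>

locale normed_space_over = vector_space scale
  for scale :: "'k::real_normed_field \<Rightarrow> 'v::real_normed_vector \<Rightarrow> 'v" +
  assumes scale_of_real: "scale (of_real r) x = r *\<^sub>R x"
    and norm_scale: "norm (scale c x) = norm c * norm x"

locale banach_algebra_over = normed_space_over scale
  for scale :: "'k::real_normed_field \<Rightarrow> 'a::{real_normed_algebra,banach} \<Rightarrow> 'a" +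
  assumes scale_mult_left: "scale c (x * y) = scale c x * y"
    and scale_mult_right: "scale c (x * y) = x * scale c y"

locale banach_bimodule_over =
  alg: banach_algebra_over scaleC + space: normed_space_over scaleX
  for scaleC :: "'k::real_normed_field \<Rightarrow> 'c::{real_normed_algebra,banach} \<Rightarrow> 'c"
    and scaleX :: "'k \<Rightarrow> 'x::banach \<Rightarrow> 'x" +
  fixes l :: "'c \<Rightarrow> 'x \<Rightarrow> 'x" and r :: "'x \<Rightarrow> 'c \<Rightarrow> 'x"
  assumes bounded_bilinear_left: "bounded_bilinear l"
    and bounded_bilinear_right: "bounded_bilinear r"
    and left_scale1: "l (scaleC k c) x = scaleX k (l c x)"
    and left_scale2: "l c (scaleX k x) = scaleX k (l c x)"
    and right_scale1: "r (scaleX k x) c = scaleX k (r x c)"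
    and right_scale2: "r x (scaleC k c) = scaleX k (r x c)"
    and left_mult: "l (c * d) x = l c (l d x)"
    and right_mult: "r x (c * d) = r (r x c) d"
    and left_right: "r (l c x) d = l c (r x d)"

definition compatible_actions ::
  "('b::real_normed_algebra \<Rightarrow> 'a::real_normed_algebra \<Rightarrow> 'a) \<Rightarrow> ('a \<Rightarrow> 'b \<Rightarrow> 'a) \<Rightarrow> bool" where
  "compatible_actions l r \<longleftrightarrow>
     (\<forall>a b \<beta>. l \<beta> (a * b) = l \<beta> a * b \<and> r (a * b) \<beta> = a * r b \<beta> \<and> a * l \<beta> b = r a \<beta> * b)"


subsection \<open>The amalgamated duplication\<close>

text \<open>
  A separate type is needed because the product type of the library carries the Euclidean norm.
  The multiplication depends on the two actions, so it is not an instance of \<^class>\<open>times\<close>.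
\<close>

datatype ('a, 'b) dup = Dup (dfst: 'a) (dsnd: 'b)

instantiation dup :: (real_vector, real_vector) real_vector
begin

definition "0 = Dup 0 0"
definition "x + y = Dup (dfst x + dfst y) (dsnd x + dsnd y)"
definition "x - y = Dup (dfst x - dfst y) (dsnd x - dsnd y)"
definition "- x = Dup (- dfst x) (- dsnd x)"
definition "c *\<^sub>R x = Dup (c *\<^sub>R dfst x) (c *\<^sub>R dsnd x)"

instance
  by standard (auto simp: zero_dup_def plus_dup_def minus_dup_def uminus_dup_def scaleR_dup_def
      algebra_simps dup.expand)

end

instantiation dup :: (real_normed_vector, real_normed_vector) real_normed_vector
begin

definition "norm x = norm (dfst x) + norm (dsnd x)"
definition "dist x y = norm (x - y)" for x y :: "('a, 'b) dup"
definition "sgn x = x /\<^sub>R norm x" for x :: "('a, 'b) dup"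
definition [code del]:
  "(uniformity :: (('a, 'b) dup \<times> ('a, 'b) dup) filter) = (INF e\<in>{0<..}. principal {(x, y). dist x y < e})"
definition [code del]:
  "open U = (\<forall>x\<in>U. \<forall>\<^sub>F (x', y) in uniformity. x' = x \<longrightarrow> y \<in> U)" for U :: "('a, 'b) dup set"

instance
proof
  fix x y :: "('a, 'b) dup"
  show "norm (x + y) \<le> norm x + norm y"
    using norm_triangle_ineq[of "dfst x" "dfst y"] norm_triangle_ineq[of "dsnd x" "dsnd y"]
    by (simp add: norm_dup_def plus_dup_def)
  show "(norm x = 0) = (x = 0)"
    by (cases x) (simp add: norm_dup_def zero_dup_def add_nonneg_eq_0_iff)
qed (auto simp: scaleR_dup_def norm_dup_def dist_dup_def sgn_dup_def uniformity_dup_def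
      open_dup_def algebra_simps)

end

instance dup :: (banach, banach) banach
proof
  fix X :: "nat \<Rightarrow> ('a, 'b) dup"
  assume X: "Cauchy X"
  have "bounded_linear (dfst :: ('a, 'b) dup \<Rightarrow> 'a)" "bounded_linear (dsnd :: ('a, 'b) dup \<Rightarrow> 'b)"
    by (auto intro!: bounded_linear_intro[where K = 1] simp: plus_dup_def scaleR_dup_def norm_dup_def)
  then have "Cauchy (\<lambda>n. dfst (X n))" "Cauchy (\<lambda>n. dsnd (X n))"
    using X by (auto intro: bounded_linear.Cauchy)
  then obtain a b where ab: "(\<lambda>n. dfst (X n)) \<longlonglongrightarrow> a" "(\<lambda>n. dsnd (X n)) \<longlonglongrightarrow> b"
    by (metis Cauchy_convergent_iff convergent_def)
  have "(\<lambda>n. dist (dfst (X n)) a + dist (dsnd (X n)) b) \<longlonglongrightarrow> 0 + 0"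
    by (intro tendsto_add ab[THEN tendsto_dist_iff[THEN iffD1]])
  hence "(\<lambda>n. dist (X n) (Dup a b)) \<longlonglongrightarrow> 0"
    by (simp add: dist_dup_def norm_dup_def minus_dup_def dist_norm)
  thus "convergent X"
    by (blast intro: convergentI tendsto_dist_iff[THEN iffD2])
qed

definition dup_scale :: "('k \<Rightarrow> 'a \<Rightarrow> 'a) \<Rightarrow> ('k \<Rightarrow> 'b \<Rightarrow> 'b) \<Rightarrow> 'k \<Rightarrow> ('a, 'b) dup \<Rightarrow> ('a, 'b) dup" where
  "dup_scale sA sB c x = Dup (sA c (dfst x)) (sB c (dsnd x))"

definition dup_mult ::
  "('b::real_normed_algebra \<Rightarrow> 'a::real_normed_algebra \<Rightarrow> 'a) \<Rightarrow> ('a \<Rightarrow> 'b \<Rightarrow> 'a)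
    \<Rightarrow> ('a, 'b) dup \<Rightarrow> ('a, 'b) dup \<Rightarrow> ('a, 'b) dup" where
  "dup_mult l r x y =
     Dup (dfst x * dfst y + r (dfst x) (dsnd y) + l (dsnd x) (dfst y)) (dsnd x * dsnd y)"


subsection \<open>Iterated duals\<close>

text \<open>
  No HOL type built from \<^typ>\<open>'a\<close> alone can contain the \<open>k\<close>-th duals of \<^typ>\<open>'a\<close> for all \<open>k\<close>
  (their cardinalities are unbounded below \<open>beth\<^sub>\<omega>\<close>). The duals up to a given height \<open>N\<close> are
  therefore carried by subspaces \<open>lev 0, \<dots>, lev N\<close> of a type \<^typ>\<open>'u\<close>, which is a type variable in
  all results, together with the pairings between consecutive levels. For each \<open>N\<close> the product of
  the first \<open>N\<close> duals with the space itself is a possible choice of \<^typ>\<open>'u\<close>; levels above \<open>N\<close> are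
  irrelevant. Any two realizations are isometrically isomorphic, compatibly with the pairings.
\<close>

record ('k, 'a, 'u) tower =
  uscale :: "'k \<Rightarrow> 'u \<Rightarrow> 'u"
  base :: "'a \<Rightarrow> 'u"   \<comment> \<open>isometric isomorphism of the space onto level 0\<close>
  lev :: "nat \<Rightarrow> 'u set"
  pairing :: "nat \<Rightarrow> 'u \<Rightarrow> 'u \<Rightarrow> 'k"   \<comment> \<open>\<open>pairing k f x\<close> for \<open>f\<close> in level \<open>k + 1\<close>, \<open>x\<close> in level \<open>k\<close>\<close>

definition bounded_functional_on ::
  "('k::real_normed_field \<Rightarrow> 'u::real_normed_vector \<Rightarrow> 'u) \<Rightarrow> 'u set \<Rightarrow> ('u \<Rightarrow> 'k) \<Rightarrow> bool" where
  "bounded_functional_on s X \<phi> \<longleftrightarrow>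
     (\<forall>x\<in>X. \<forall>y\<in>X. \<phi> (x + y) = \<phi> x + \<phi> y) \<and>
     (\<forall>c. \<forall>x\<in>X. \<phi> (s c x) = c * \<phi> x) \<and>
     (\<exists>K. \<forall>x\<in>X. norm (\<phi> x) \<le> K * norm x)"

text \<open>\<open>f \<mapsto> p f\<close> is an isometric isomorphism of \<open>Y\<close> onto the dual of \<open>X\<close>.\<close>

definition is_dual_of ::
  "('k::real_normed_field \<Rightarrow> 'u::real_normed_vector \<Rightarrow> 'u) \<Rightarrow> ('u \<Rightarrow> 'u \<Rightarrow> 'k) \<Rightarrow> 'u set \<Rightarrow> 'u set \<Rightarrow> bool" where
  "is_dual_of s p Y X \<longleftrightarrow>
     module.subspace s Y \<and>
     (\<forall>f\<in>Y. \<forall>g\<in>Y. \<forall>x\<in>X. p (f + g) x = p f x + p g x) \<and>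
     (\<forall>c. \<forall>f\<in>Y. \<forall>x\<in>X. p (s c f) x = c * p f x) \<and>
     (\<forall>f\<in>Y. bounded_functional_on s X (p f)) \<and>
     (\<forall>\<phi>. bounded_functional_on s X \<phi> \<longrightarrow> (\<exists>!f. f \<in> Y \<and> (\<forall>x\<in>X. p f x = \<phi> x))) \<and>
     (\<forall>f\<in>Y. norm f = (SUP x\<in>{x\<in>X. norm x \<le> 1}. norm (p f x)))"

definition dual_tower ::
  "nat \<Rightarrow> ('k::real_normed_field \<Rightarrow> 'a::real_normed_vector \<Rightarrow> 'a)
    \<Rightarrow> ('k, 'a, 'u::real_normed_vector) tower \<Rightarrow> bool" where
  "dual_tower N s T \<longleftrightarrow>
     normed_space_over (uscale T) \<and>
     Vector_Spaces.linear s (uscale T) (base T) \<and>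
     (\<forall>a. norm (base T a) = norm a) \<and>
     lev T 0 = range (base T) \<and>
     (\<forall>k<N. is_dual_of (uscale T) (pairing T k) (lev T (Suc k)) (lev T k))"

definition functional :: "('k, 'a, 'u) tower \<Rightarrow> nat \<Rightarrow> ('u \<Rightarrow> 'k) \<Rightarrow> 'u" where
  "functional T k \<phi> = (THE f. f \<in> lev T (Suc k) \<and> (\<forall>x\<in>lev T k. pairing T k f x = \<phi> x))"


subsection \<open>Actions on iterated duals\<close>

text \<open>The actions induced on level \<open>k\<close> by the actions \<open>l\<close>, \<open>r\<close> of \<^typ>\<open>'c\<close> on \<^typ>\<open>'a\<close>.\<close>

fun lact :: "('k, 'a, 'u) tower \<Rightarrow> ('c \<Rightarrow> 'a \<Rightarrow> 'a) \<Rightarrow> ('a \<Rightarrow> 'c \<Rightarrow> 'a) \<Rightarrow> nat \<Rightarrow> 'c \<Rightarrow> 'u \<Rightarrow> 'u"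
  and ract :: "('k, 'a, 'u) tower \<Rightarrow> ('c \<Rightarrow> 'a \<Rightarrow> 'a) \<Rightarrow> ('a \<Rightarrow> 'c \<Rightarrow> 'a) \<Rightarrow> nat \<Rightarrow> 'u \<Rightarrow> 'c \<Rightarrow> 'u" where
  "lact T l r 0 c x = base T (l c (inv (base T) x))"
| "ract T l r 0 x c = base T (r (inv (base T) x) c)"
| "lact T l r (Suc k) c f = functional T k (\<lambda>x. pairing T k f (ract T l r k x c))"
| "ract T l r (Suc k) f c = functional T k (\<lambda>x. pairing T k f (lact T l r k c x))"

text \<open>
  The mixed operations, for \<open>l\<close>, \<open>r\<close> the actions of \<^typ>\<open>'b\<close> on \<^typ>\<open>'a\<close>. The even ones with index
  \<open>m\<close> map level \<open>2m\<close> over \<^typ>\<open>'b\<close> to level \<open>2m\<close> over \<^typ>\<open>'a\<close>; the odd ones with index \<open>m\<close> map level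
  \<open>2m + 1\<close> over \<^typ>\<open>'a\<close> to level \<open>2m + 1\<close> over \<^typ>\<open>'b\<close>. The element of \<^typ>\<open>'a\<close> is on the left in
  \<open>mixl\<close> and on the right in \<open>mixr\<close>. As dualization exchanges sides, the recursion splits into
  two independent ones.
\<close>

fun mixl_even :: "('k, 'a, 'u) tower \<Rightarrow> ('k, 'b, 'v) tower \<Rightarrow> ('b \<Rightarrow> 'a \<Rightarrow> 'a) \<Rightarrow> ('a \<Rightarrow> 'b \<Rightarrow> 'a)
      \<Rightarrow> nat \<Rightarrow> 'a \<Rightarrow> 'v \<Rightarrow> 'u"
  and mixr_odd :: "('k, 'a, 'u) tower \<Rightarrow> ('k, 'b, 'v) tower \<Rightarrow> ('b \<Rightarrow> 'a \<Rightarrow> 'a) \<Rightarrow> ('a \<Rightarrow> 'b \<Rightarrow> 'a)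
      \<Rightarrow> nat \<Rightarrow> 'u \<Rightarrow> 'a \<Rightarrow> 'v" where
  "mixl_even TA TB l r 0 a y = base TA (r a (inv (base TB) y))"
| "mixl_even TA TB l r (Suc m) a y =
     functional TA (2 * m + 1) (\<lambda>x. pairing TB (2 * m + 1) y (mixr_odd TA TB l r m x a))"
| "mixr_odd TA TB l r m x a =
     functional TB (2 * m) (\<lambda>y. pairing TA (2 * m) x (mixl_even TA TB l r m a y))"

fun mixr_even :: "('k, 'a, 'u) tower \<Rightarrow> ('k, 'b, 'v) tower \<Rightarrow> ('b \<Rightarrow> 'a \<Rightarrow> 'a) \<Rightarrow> ('a \<Rightarrow> 'b \<Rightarrow> 'a)
      \<Rightarrow> nat \<Rightarrow> 'v \<Rightarrow> 'a \<Rightarrow> 'u"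
  and mixl_odd :: "('k, 'a, 'u) tower \<Rightarrow> ('k, 'b, 'v) tower \<Rightarrow> ('b \<Rightarrow> 'a \<Rightarrow> 'a) \<Rightarrow> ('a \<Rightarrow> 'b \<Rightarrow> 'a)
      \<Rightarrow> nat \<Rightarrow> 'a \<Rightarrow> 'u \<Rightarrow> 'v" where
  "mixr_even TA TB l r 0 y a = base TA (l (inv (base TB) y) a)"
| "mixr_even TA TB l r (Suc m) y a =
     functional TA (2 * m + 1) (\<lambda>x. pairing TB (2 * m + 1) y (mixl_odd TA TB l r m a x))"
| "mixl_odd TA TB l r m a x =
     functional TB (2 * m) (\<lambda>y. pairing TA (2 * m) x (mixr_even TA TB l r m y a))"


subsection \<open>Derivations and weak amenability\<close>

text \<open>
  Here \<open>s\<close> and \<open>mul\<close> are the scalar multiplication and the product of the algebra, and the values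
  are taken in the subspace \<open>X\<close> of \<^typ>\<open>'u\<close>.
\<close>

definition bounded_linear_into ::
  "('k::real_normed_field \<Rightarrow> 'c::real_normed_vector \<Rightarrow> 'c) \<Rightarrow> ('k \<Rightarrow> 'u::real_normed_vector \<Rightarrow> 'u)
    \<Rightarrow> 'u set \<Rightarrow> ('c \<Rightarrow> 'u) \<Rightarrow> bool" where
  "bounded_linear_into s sU X D \<longleftrightarrow>
     Vector_Spaces.linear s sU D \<and> bounded_linear D \<and> range D \<subseteq> X"

definition derivation ::
  "('k::real_normed_field \<Rightarrow> 'c::real_normed_vector \<Rightarrow> 'c) \<Rightarrow> ('c \<Rightarrow> 'c \<Rightarrow> 'c)
    \<Rightarrow> ('k \<Rightarrow> 'u::real_normed_vector \<Rightarrow> 'u) \<Rightarrow> 'u set \<Rightarrow> ('c \<Rightarrow> 'u \<Rightarrow> 'u) \<Rightarrow> ('u \<Rightarrow> 'c \<Rightarrow> 'u)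
    \<Rightarrow> ('c \<Rightarrow> 'u) \<Rightarrow> bool" where
  "derivation s mul sU X L R D \<longleftrightarrow>
     bounded_linear_into s sU X D \<and> (\<forall>c d. D (mul c d) = R (D c) d + L c (D d))"

definition inner_derivation ::
  "'u::real_normed_vector set \<Rightarrow> ('c \<Rightarrow> 'u \<Rightarrow> 'u) \<Rightarrow> ('u \<Rightarrow> 'c \<Rightarrow> 'u) \<Rightarrow> ('c \<Rightarrow> 'u) \<Rightarrow> bool" where
  "inner_derivation X L R D \<longleftrightarrow> (\<exists>x\<in>X. \<forall>c. D c = L c x - R x c)"

definition weakly_amenable ::
  "nat \<Rightarrow> ('k::real_normed_field \<Rightarrow> 'c::real_normed_vector \<Rightarrow> 'c) \<Rightarrow> ('c \<Rightarrow> 'c \<Rightarrow> 'c)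
    \<Rightarrow> ('k, 'c, 'u::real_normed_vector) tower \<Rightarrow> bool" where
  "weakly_amenable k s mul T \<longleftrightarrow>
     (\<forall>D. derivation s mul (uscale T) (lev T k) (lact T mul mul k) (ract T mul mul k) D
        \<longrightarrow> inner_derivation (lev T k) (lact T mul mul k) (ract T mul mul k) D)"

text \<open>The property \<open>(\<bbbH>\<^sub>k)\<close> for \<open>k = 2n + 1\<close>.\<close>

definition property_H ::
  "nat \<Rightarrow> ('k::real_normed_field \<Rightarrow> 'a::real_normed_algebra \<Rightarrow> 'a)
    \<Rightarrow> ('k \<Rightarrow> 'b::real_normed_algebra \<Rightarrow> 'b) \<Rightarrow> ('b \<Rightarrow> 'a \<Rightarrow> 'a) \<Rightarrow> ('a \<Rightarrow> 'b \<Rightarrow> 'a)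
    \<Rightarrow> ('k, 'a, 'u::real_normed_vector) tower \<Rightarrow> ('k, 'b, 'v::real_normed_vector) tower \<Rightarrow> bool" where
  "property_H n sA sB l r TA TB \<longleftrightarrow>
     (let k = 2 * n + 1;
          AA_l = lact TA (*) (*) k; AA_r = ract TA (*) (*) k;
          BB_l = lact TB (*) (*) k; BB_r = ract TB (*) (*) k;
          BA_l = lact TA l r k; BA_r = ract TA l r k;
          AB_l = mixl_odd TA TB l r n; AB_r = mixr_odd TA TB l r n
      in \<forall>D1A. derivation sA (*) (uscale TA) (lev TA k) AA_l AA_r D1A \<longrightarrow>
           (\<exists>D1B D2A.
              derivation sB (*) (uscale TA) (lev TA k) BA_l BA_r D1B \<and>
              bounded_linear_into sA (uscale TB) (lev TB k) D2A \<and>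
              (\<forall>a b \<beta>.
                 D1A (l \<beta> a) = AA_r (D1B \<beta>) a + BA_l \<beta> (D1A a) \<and>
                 D1A (r a \<beta>) = AA_l a (D1B \<beta>) + BA_r (D1A a) \<beta> \<and>
                 D2A (l \<beta> a) = AB_r (D1B \<beta>) a + BB_l \<beta> (D2A a) \<and>
                 D2A (r a \<beta>) = AB_l a (D1B \<beta>) + BB_r (D2A a) \<beta> \<and>
                 D2A (a * b) = AB_r (D1A a) b + AB_l a (D1A b))))"

end

theory Submission
  imports Defs
begin

text \<open>
  The iterated duals enter only through one functor. A bounded linear map \<open>\<phi>\<close> from \<open>X\<close> to \<open>Y\<close>
  induces, by taking transposes \<open>2n + 1\<close> times, a bounded linear map \<open>F \<phi>\<close> from the
  \<open>(2n + 1)\<close>-st dual of \<open>Y\<close> to that of \<open>X\<close> (\<open>odd_transpose\<close>), and \<open>F\<close> is contravariant and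
  additive (\<open>odd_transpose_comp\<close>, \<open>odd_transpose_sum\<close>). All actions on the \<open>(2n + 1)\<close>-st duals, and
  the mixed operations, are values of \<open>F\<close> at one-sided multiplications (\<open>lact_odd\<close>, \<open>ract_odd\<close>,
  \<open>mixl_odd_eq_transpose\<close>, \<open>mixr_odd_eq_transpose\<close>). Every identity needed between them is therefore
  the image under \<open>F\<close> of an identity between maps of the algebras themselves, which is visible from
  the formula for the product of the duplication.

  Let \<open>C\<close> be the duplication, \<open>p\<close> and \<open>q\<close> its projections to the two factors, and \<open>i\<close>, \<open>j\<close> the
  inclusions \<open>a \<mapsto> (a, 0)\<close> and \<open>\<beta> \<mapsto> (0, \<beta>)\<close>. The maps \<open>q\<close>, \<open>i\<close> and \<open>j\<close> are homomorphisms, so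
  their images under \<open>F\<close> are homomorphisms of bimodules (\<open>odd_transpose_action\<close>). Consequently inner
  derivations of \<open>C\<close> restrict along \<open>i\<close> and \<open>j\<close> to inner derivations
  (\<open>inner_derivation_pullback\<close>).

  For (i), a derivation \<open>D\<close> of the second factor gives the derivation \<open>F q \<circ> D \<circ> q\<close> of \<open>C\<close>. It is
  inner, and restricting it along \<open>j\<close> gives back \<open>D\<close>, since \<open>q \<circ> j\<close> is the identity
  (\<open>weakly_amenable_retract\<close>).

  For (ii), \<open>p\<close> is not a homomorphism in general, and the defect is exactly the term of the product that the
  mixed operations dualize (\<open>dup_action_odd_transpose_dfst\<close>). Given a derivation \<open>D1A\<close> of the
  first factor, the maps \<open>D1B\<close> and \<open>D2A\<close> from \<open>property_H\<close> are what is needed for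
  \<open>(a, \<beta>) \<mapsto> F p (D1A a + D1B \<beta>) + F q (D2A a)\<close> to be a derivation (\<open>derivation_dup\<close>). It is inner,
  and restricting it along \<open>i\<close> gives back \<open>D1A\<close>, since \<open>p \<circ> i\<close> is the identity and
  \<open>q \<circ> i = 0\<close>.
\<close>

section \<open>Levels of a tower of duals\<close>

lemma subspace_closed:
  assumes "normed_space_over s" "module.subspace s X"
  shows "0 \<in> X" and "x \<in> X \<Longrightarrow> y \<in> X \<Longrightarrow> x + y \<in> X" and "x \<in> X \<Longrightarrow> s c x \<in> X"
proof -
  interpret normed_space_over s by fact
  show "0 \<in> X" "x \<in> X \<Longrightarrow> y \<in> X \<Longrightarrow> x + y \<in> X" "x \<in> X \<Longrightarrow> s c x \<in> X"
    using assms(2) by (auto intro: subspace_0 subspace_add subspace_scale)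
qed

context
  fixes N :: nat
    and s :: "'k::real_normed_field \<Rightarrow> 'a::real_normed_vector \<Rightarrow> 'a"
    and T :: "('k, 'a, 'u::real_normed_vector) tower"
  assumes tower: "dual_tower N s T"
begin

lemma tower_normed_space: "normed_space_over (uscale T)"
  using tower by (simp add: dual_tower_def)

lemma tower_scaleR: "uscale T (of_real c) x = c *\<^sub>R x"
  using tower_normed_space by (simp add: normed_space_over_def normed_space_over_axioms_def)

lemma tower_norm_scale: "norm (uscale T c x) = norm c * norm x"
  using tower_normed_space by (simp add: normed_space_over_def normed_space_over_axioms_def)

lemma base_linear:
  "base T (a + b) = base T a + base T b" "base T (s c a) = uscale T c (base T a)"
  using tower by (simp_all add: dual_tower_def Vector_Spaces.linear_iff)

lemma norm_base: "norm (base T a) = norm a"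
  using tower by (simp add: dual_tower_def)

lemma lev_0: "lev T 0 = range (base T)"
  using tower by (simp add: dual_tower_def)

lemma inv_base [simp]: "inv (base T) (base T a) = a"
proof -
  have "inj (base T)"
  proof (rule injI)
    fix x y assume "base T x = base T y"
    moreover have "base T x = base T (x - y) + base T y"
      by (simp flip: base_linear)
    ultimately have "norm (x - y) = 0"
      by (simp flip: norm_base)
    then show "x = y" by simp
  qed
  then show ?thesis by simp
qed

lemma lev_Suc:
  assumes "k < N"
  shows "is_dual_of (uscale T) (pairing T k) (lev T (Suc k)) (lev T k)"
  using tower assms by (simp add: dual_tower_def)

lemma lev_subspace:
  assumes "k \<le> N"
  shows "module.subspace (uscale T) (lev T k)"
proof (cases k)
  case 0
  interpret normed_space_over "uscale T" by (rule tower_normed_space)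
  have "module_hom s (uscale T) (base T)"
    using tower by (simp add: dual_tower_def module_hom_iff_linear)
  then interpret module_hom s "uscale T" "base T" .
  show ?thesis using 0 subspace_image[OF m1.subspace_UNIV] by (simp add: lev_0)
next
  case (Suc j)
  then show ?thesis using lev_Suc[of j] assms by (simp add: is_dual_of_def)
qed

lemma lev_closed:
  assumes "k \<le> N"
  shows "0 \<in> lev T k" and "x \<in> lev T k \<Longrightarrow> y \<in> lev T k \<Longrightarrow> x + y \<in> lev T k"
    and "x \<in> lev T k \<Longrightarrow> uscale T c x \<in> lev T k"
  using subspace_closed[OF tower_normed_space lev_subspace[OF assms]] by auto

context
  fixes k :: nat
  assumes k: "k < N"
begin

lemma pairing_left:
  assumes "f \<in> lev T (Suc k)" "x \<in> lev T k"
  shows "g \<in> lev T (Suc k) \<Longrightarrow> pairing T k (f + g) x = pairing T k f x + pairing T k g x"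
    and "pairing T k (uscale T c f) x = c * pairing T k f x"
  using lev_Suc[OF k] assms by (auto simp: is_dual_of_def)

lemma pairing_bounded_functional:
  assumes "f \<in> lev T (Suc k)"
  shows "bounded_functional_on (uscale T) (lev T k) (pairing T k f)"
  using lev_Suc[OF k] assms by (auto simp: is_dual_of_def)

lemma pairing_right:
  assumes "f \<in> lev T (Suc k)" "x \<in> lev T k"
  shows "y \<in> lev T k \<Longrightarrow> pairing T k f (x + y) = pairing T k f x + pairing T k f y"
    and "pairing T k f (uscale T c x) = c * pairing T k f x"
  using pairing_bounded_functional[OF assms(1)] assms(2) by (auto simp: bounded_functional_on_def)

lemma lev_eqI:
  assumes "f \<in> lev T (Suc k)" "g \<in> lev T (Suc k)"
    and "\<And>x. x \<in> lev T k \<Longrightarrow> pairing T k f x = pairing T k g x"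
  shows "f = g"
proof -
  have "\<exists>!h. h \<in> lev T (Suc k) \<and> (\<forall>x\<in>lev T k. pairing T k h x = pairing T k g x)"
    using lev_Suc[OF k] pairing_bounded_functional[OF assms(2)] by (simp add: is_dual_of_def)
  then show ?thesis using assms by blast
qed

lemma functional:
  assumes "bounded_functional_on (uscale T) (lev T k) \<phi>"
  shows "functional T k \<phi> \<in> lev T (Suc k)"
    and "x \<in> lev T k \<Longrightarrow> pairing T k (functional T k \<phi>) x = \<phi> x"
proof -
  have "\<exists>!f. f \<in> lev T (Suc k) \<and> (\<forall>x\<in>lev T k. pairing T k f x = \<phi> x)"
    using lev_Suc[OF k] assms by (auto simp: is_dual_of_def)
  from theI'[OF this]
  show "functional T k \<phi> \<in> lev T (Suc k)"
    and "x \<in> lev T k \<Longrightarrow> pairing T k (functional T k \<phi>) x = \<phi> x"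
    by (auto simp: functional_def)
qed

lemma norm_dual:
  assumes "f \<in> lev T (Suc k)"
  shows "norm f = (SUP x\<in>{x\<in>lev T k. norm x \<le> 1}. norm (pairing T k f x))"
  using lev_Suc[OF k] assms by (auto simp: is_dual_of_def)

lemma norm_pairing_le:
  assumes f: "f \<in> lev T (Suc k)" and x: "x \<in> lev T k"
  shows "norm (pairing T k f x) \<le> norm f * norm x"
proof -
  obtain K where K: "\<And>x. x \<in> lev T k \<Longrightarrow> norm (pairing T k f x) \<le> K * norm x"
    using pairing_bounded_functional[OF f] unfolding bounded_functional_on_def by blast
  show ?thesis
  proof (cases "x = 0")
    case True
    then show ?thesis using K[OF x] by simp
  next
    case False
    \<comment> \<open>The norm of \<open>f\<close> is a supremum over the unit ball, so the bound is read off at \<open>x / \<parallel>x\<parallel>\<close>.\<close>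
    define y where "y = uscale T (of_real (inverse (norm x))) x"
    have y: "y \<in> lev T k" "norm y \<le> 1"
      using x k False lev_closed[of k] by (auto simp: y_def tower_norm_scale norm_inverse)
    have "norm (pairing T k f z) \<le> \<bar>K\<bar>" if "z \<in> lev T k" "norm z \<le> 1" for z
    proof -
      have "K * norm z \<le> \<bar>K\<bar> * 1"
        using that by (intro mult_mono) auto
      then show ?thesis using K[OF that(1)] by simp
    qed
    then have "bdd_above ((\<lambda>z. norm (pairing T k f z)) ` {z\<in>lev T k. norm z \<le> 1})"
      by (intro bdd_aboveI2) auto
    then have "norm (pairing T k f y) \<le> norm f"
      unfolding norm_dual[OF f] using y by (intro cSUP_upper) auto
    moreover have "norm (pairing T k f y) = norm (pairing T k f x) / norm x"
      unfolding y_def by (subst pairing_right[OF f x]) (simp add: norm_mult divide_inverse mult.commute norm_inverse)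
    ultimately show ?thesis using False by (simp add: field_simps)
  qed
qed

lemma norm_lev_le:
  assumes f: "f \<in> lev T (Suc k)"
    and le: "\<And>x. x \<in> lev T k \<Longrightarrow> norm (pairing T k f x) \<le> K * norm x" and K: "K \<ge> 0"
  shows "norm f \<le> K"
  unfolding norm_dual[OF f]
proof (rule cSUP_least)
  show "{x \<in> lev T k. norm x \<le> 1} \<noteq> {}"
    using lev_closed[of k] k by (auto intro!: exI[of _ 0])
  fix x assume "x \<in> {x \<in> lev T k. norm x \<le> 1}"
  then show "norm (pairing T k f x) \<le> K"
    using le[of x] mult_left_le[OF _ K, of "norm x"] by auto
qed

end

end

section \<open>Transposes of bounded maps between levels\<close>

text \<open>
  Boundedness and linearity are required on the subspace \<open>X\<close> only: all levels of a tower are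
  carried by one type, and the maps between levels are arbitrary outside their own level.
\<close>
definition bounded_map_on ::
  "('k::real_normed_field \<Rightarrow> 'u::real_normed_vector \<Rightarrow> 'u) \<Rightarrow> ('k \<Rightarrow> 'v::real_normed_vector \<Rightarrow> 'v)
    \<Rightarrow> 'u set \<Rightarrow> 'v set \<Rightarrow> ('u \<Rightarrow> 'v) \<Rightarrow> bool" where
  "bounded_map_on s s' X Y S \<longleftrightarrow>
     S ` X \<subseteq> Y \<and>
     (\<forall>x\<in>X. \<forall>y\<in>X. S (x + y) = S x + S y) \<and>
     (\<forall>c. \<forall>x\<in>X. S (s c x) = s' c (S x)) \<and>
     (\<exists>K. \<forall>x\<in>X. norm (S x) \<le> K * norm x)"

text \<open>
  The Banach space adjoint of a map \<open>S\<close> from level \<open>k\<close> over \<open>X\<close> to level \<open>k\<close> over \<open>Y\<close>. The actions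
  on dual levels and the mixed operations are literally of this form, so proving that it is bounded
  once covers all of them.
\<close>
definition level_transpose ::
  "('k, 'a, 'u) tower \<Rightarrow> ('k, 'b, 'v) tower \<Rightarrow> nat \<Rightarrow> ('u \<Rightarrow> 'v) \<Rightarrow> 'v \<Rightarrow> 'u" where
  "level_transpose TX TY k S g = functional TX k (\<lambda>x. pairing TY k g (S x))"

context
  fixes N :: nat
    and sX :: "'k::real_normed_field \<Rightarrow> 'x::real_normed_vector \<Rightarrow> 'x"
    and sY :: "'k \<Rightarrow> 'y::real_normed_vector \<Rightarrow> 'y"
    and TX :: "('k, 'x, 'u::real_normed_vector) tower"
    and TY :: "('k, 'y, 'v::real_normed_vector) tower"
    and k :: nat and S :: "'u \<Rightarrow> 'v"
  assumes TX: "dual_tower N sX TX" and TY: "dual_tower N sY TY" and k: "k < N"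
    and S: "bounded_map_on (uscale TX) (uscale TY) (lev TX k) (lev TY k) S"
begin

text \<open>
  The operator \<open>functional\<close> is a definite description; it has a meaning only at bounded functionals.
  This is the fact that makes every transpose below well defined.
\<close>
lemma pairing_comp_bounded_functional:
  assumes g: "g \<in> lev TY (Suc k)"
  shows "bounded_functional_on (uscale TX) (lev TX k) (\<lambda>x. pairing TY k g (S x))"
proof -
  obtain K where K: "\<And>x. x \<in> lev TX k \<Longrightarrow> norm (S x) \<le> K * norm x"
    using S unfolding bounded_map_on_def by blast
  have "norm (pairing TY k g (S x)) \<le> (norm g * K) * norm x" if x: "x \<in> lev TX k" for x
  proof -
    have "norm (pairing TY k g (S x)) \<le> norm g * norm (S x)"
      using S x by (intro norm_pairing_le[OF TY k g]) (auto simp: bounded_map_on_def)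
    also have "\<dots> \<le> norm g * (K * norm x)"
      by (intro mult_left_mono K x) auto
    finally show ?thesis by (simp add: mult.assoc)
  qed
  moreover have "S x \<in> lev TY k" if "x \<in> lev TX k" for x
    using that S by (auto simp: bounded_map_on_def)
  moreover have "S (x + y) = S x + S y" "S (uscale TX c x) = uscale TY c (S x)"
    if "x \<in> lev TX k" "y \<in> lev TX k" for x y c
    using that S by (auto simp: bounded_map_on_def)
  ultimately show ?thesis
    unfolding bounded_functional_on_def
    by (intro conjI ballI allI exI[of _ "norm g * K"]) (simp_all add: pairing_right[OF TY k g])
qed

lemma level_transpose_mem: "g \<in> lev TY (Suc k) \<Longrightarrow> level_transpose TX TY k S g \<in> lev TX (Suc k)"
  unfolding level_transpose_def by (rule functional[OF TX k pairing_comp_bounded_functional])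

lemma pairing_level_transpose:
  "g \<in> lev TY (Suc k) \<Longrightarrow> x \<in> lev TX k \<Longrightarrow>
    pairing TX k (level_transpose TX TY k S g) x = pairing TY k g (S x)"
  unfolding level_transpose_def by (rule functional[OF TX k pairing_comp_bounded_functional])

lemma bounded_map_on_level_transpose:
  "bounded_map_on (uscale TY) (uscale TX) (lev TY (Suc k)) (lev TX (Suc k)) (level_transpose TX TY k S)"
proof -
  note closed = lev_closed[OF TY Suc_leI[OF k]] lev_closed[OF TX Suc_leI[OF k]]
  have S_mem: "S x \<in> lev TY k" if "x \<in> lev TX k" for x
    using that S by (auto simp: bounded_map_on_def)
  obtain K where K: "\<And>x. x \<in> lev TX k \<Longrightarrow> norm (S x) \<le> K * norm x"
    using S unfolding bounded_map_on_def by blast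
  have norm: "norm (level_transpose TX TY k S g) \<le> \<bar>K\<bar> * norm g" if g: "g \<in> lev TY (Suc k)" for g
  proof (rule norm_lev_le[OF TX k level_transpose_mem[OF g]])
    fix x assume x: "x \<in> lev TX k"
    have "norm (pairing TX k (level_transpose TX TY k S g) x) \<le> norm g * norm (S x)"
      unfolding pairing_level_transpose[OF g x] by (rule norm_pairing_le[OF TY k g S_mem[OF x]])
    also have "\<dots> \<le> norm g * (\<bar>K\<bar> * norm x)"
      by (rule mult_left_mono[OF order.trans[OF K[OF x]]]) (simp_all add: mult_right_mono)
    finally show "norm (pairing TX k (level_transpose TX TY k S g) x) \<le> \<bar>K\<bar> * norm g * norm x"
      by (simp add: ac_simps)
  qed simp
  have add: "level_transpose TX TY k S (f + g) = level_transpose TX TY k S f + level_transpose TX TY k S g"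
    if "f \<in> lev TY (Suc k)" "g \<in> lev TY (Suc k)" for f g
    using that
    by (intro lev_eqI[OF TX k])
      (simp_all add: pairing_left[OF TX k] pairing_left[OF TY k] pairing_level_transpose level_transpose_mem closed S_mem)
  have scale: "level_transpose TX TY k S (uscale TY c g) = uscale TX c (level_transpose TX TY k S g)"
    if "g \<in> lev TY (Suc k)" for c g
    using that
    by (intro lev_eqI[OF TX k])
      (simp_all add: pairing_left[OF TX k] pairing_left[OF TY k] pairing_level_transpose level_transpose_mem closed S_mem)
  show ?thesis
    unfolding bounded_map_on_def
  proof (intro conjI)
    show "level_transpose TX TY k S ` lev TY (Suc k) \<subseteq> lev TX (Suc k)"
      using level_transpose_mem by auto
    show "\<exists>K. \<forall>x\<in>lev TY (Suc k). norm (level_transpose TX TY k S x) \<le> K * norm x"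
      using norm by blast
  qed (use add scale in auto)
qed

end

section \<open>Iterated transposes of a bounded map\<close>

text \<open>
  Transposition reverses arrows, so a map \<open>\<phi>\<close> from \<open>X\<close> to \<open>Y\<close> yields, alternately, maps from
  level \<open>2m\<close> over \<open>X\<close> to level \<open>2m\<close> over \<open>Y\<close> (\<open>even_transpose\<close>) and maps from level
  \<open>2m + 1\<close> over \<open>Y\<close> to level \<open>2m + 1\<close> over \<open>X\<close> (\<open>odd_transpose\<close>).
\<close>
fun even_transpose :: "('k, 'x, 'u) tower \<Rightarrow> ('k, 'y, 'v) tower \<Rightarrow> ('x \<Rightarrow> 'y) \<Rightarrow> nat \<Rightarrow> 'u \<Rightarrow> 'v"
  and odd_transpose :: "('k, 'x, 'u) tower \<Rightarrow> ('k, 'y, 'v) tower \<Rightarrow> ('x \<Rightarrow> 'y) \<Rightarrow> nat \<Rightarrow> 'v \<Rightarrow> 'u" where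
  "even_transpose TX TY \<phi> 0 = (\<lambda>x. base TY (\<phi> (inv (base TX) x)))"
| "even_transpose TX TY \<phi> (Suc m) = level_transpose TY TX (2 * m + 1) (odd_transpose TX TY \<phi> m)"
| "odd_transpose TX TY \<phi> m = level_transpose TX TY (2 * m) (even_transpose TX TY \<phi> m)"

declare odd_transpose.simps [simp del]

abbreviation bounded_hom ::
  "('k::real_normed_field \<Rightarrow> 'x::real_normed_vector \<Rightarrow> 'x) \<Rightarrow> ('k \<Rightarrow> 'y::real_normed_vector \<Rightarrow> 'y)
    \<Rightarrow> ('x \<Rightarrow> 'y) \<Rightarrow> bool" where
  "bounded_hom sX sY \<equiv> bounded_linear_into sX sY UNIV"

lemma bounded_map_on_base:
  assumes TX: "dual_tower N sX TX" and TY: "dual_tower N sY TY" and \<phi>: "bounded_hom sX sY \<phi>"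
  shows "bounded_map_on (uscale TX) (uscale TY) (lev TX 0) (lev TY 0) (even_transpose TX TY \<phi> 0)"
proof -
  obtain K where K: "\<And>x. norm (\<phi> x) \<le> K * norm x"
    using \<phi> bounded_linear.bounded unfolding bounded_linear_into_def by (metis mult.commute)
  have "\<phi> (x + y) = \<phi> x + \<phi> y" "\<phi> (sX c x) = sY c (\<phi> x)" for x y c
    using \<phi> by (auto simp: bounded_linear_into_def Vector_Spaces.linear_iff)
  then show ?thesis
    unfolding bounded_map_on_def lev_0[OF TX] lev_0[OF TY]
    by (auto simp: inv_base[OF TX] norm_base[OF TX] norm_base[OF TY] base_linear[OF TY]
        simp flip: base_linear[OF TX] intro!: exI[of _ K] K)
qed

context
  fixes N :: nat
    and sX :: "'k::real_normed_field \<Rightarrow> 'x::real_normed_vector \<Rightarrow> 'x"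
    and sY :: "'k \<Rightarrow> 'y::real_normed_vector \<Rightarrow> 'y"
    and TX :: "('k, 'x, 'u::real_normed_vector) tower"
    and TY :: "('k, 'y, 'v::real_normed_vector) tower"
    and \<phi> :: "'x \<Rightarrow> 'y"
  assumes TX: "dual_tower N sX TX" and TY: "dual_tower N sY TY" and \<phi>: "bounded_hom sX sY \<phi>"
begin

lemma bounded_map_on_iterated_transpose:
  "2 * m \<le> N \<Longrightarrow>
    bounded_map_on (uscale TX) (uscale TY) (lev TX (2 * m)) (lev TY (2 * m)) (even_transpose TX TY \<phi> m)"
  "2 * m < N \<Longrightarrow>
    bounded_map_on (uscale TY) (uscale TX) (lev TY (2 * m + 1)) (lev TX (2 * m + 1)) (odd_transpose TX TY \<phi> m)"
proof -
  have odd: "bounded_map_on (uscale TY) (uscale TX) (lev TY (2 * m + 1)) (lev TX (2 * m + 1))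
      (odd_transpose TX TY \<phi> m)"
    if "2 * m < N" and "bounded_map_on (uscale TX) (uscale TY) (lev TX (2 * m)) (lev TY (2 * m))
      (even_transpose TX TY \<phi> m)" for m
    using bounded_map_on_level_transpose[OF TX TY that] by (simp add: odd_transpose.simps)
  have even: "bounded_map_on (uscale TX) (uscale TY) (lev TX (2 * m)) (lev TY (2 * m))
      (even_transpose TX TY \<phi> m)" if "2 * m \<le> N" for m
    using that
  proof (induction m)
    case 0
    then show ?case using bounded_map_on_base[OF TX TY \<phi>] by simp
  next
    case (Suc m)
    then show ?case
      using bounded_map_on_level_transpose[OF TY TX _ odd, of m] by simp
  qed
  show "2 * m \<le> N \<Longrightarrow>
    bounded_map_on (uscale TX) (uscale TY) (lev TX (2 * m)) (lev TY (2 * m)) (even_transpose TX TY \<phi> m)"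
    by (rule even)
  show "2 * m < N \<Longrightarrow>
    bounded_map_on (uscale TY) (uscale TX) (lev TY (2 * m + 1)) (lev TX (2 * m + 1)) (odd_transpose TX TY \<phi> m)"
    using odd even by simp
qed

lemma iterated_transpose_mem:
  "2 * m \<le> N \<Longrightarrow> x \<in> lev TX (2 * m) \<Longrightarrow> even_transpose TX TY \<phi> m x \<in> lev TY (2 * m)"
  "2 * m < N \<Longrightarrow> g \<in> lev TY (Suc (2 * m)) \<Longrightarrow> odd_transpose TX TY \<phi> m g \<in> lev TX (Suc (2 * m))"
  using bounded_map_on_iterated_transpose[of m] by (auto simp: bounded_map_on_def)

lemma odd_transpose_add:
  "2 * m < N \<Longrightarrow> f \<in> lev TY (Suc (2 * m)) \<Longrightarrow> g \<in> lev TY (Suc (2 * m)) \<Longrightarrow>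
    odd_transpose TX TY \<phi> m (f + g) = odd_transpose TX TY \<phi> m f + odd_transpose TX TY \<phi> m g"
  using bounded_map_on_iterated_transpose[of m] by (auto simp: bounded_map_on_def)

lemma pairing_iterated_transpose:
  "2 * m < N \<Longrightarrow> g \<in> lev TY (Suc (2 * m)) \<Longrightarrow> x \<in> lev TX (2 * m) \<Longrightarrow>
    pairing TX (2 * m) (odd_transpose TX TY \<phi> m g) x = pairing TY (2 * m) g (even_transpose TX TY \<phi> m x)"
  "2 * m + 1 < N \<Longrightarrow> x \<in> lev TX (Suc (Suc (2 * m))) \<Longrightarrow> g \<in> lev TY (Suc (2 * m)) \<Longrightarrow>
    pairing TY (Suc (2 * m)) (even_transpose TX TY \<phi> (Suc m) x) g
      = pairing TX (Suc (2 * m)) x (odd_transpose TX TY \<phi> m g)"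
  using pairing_level_transpose[OF TX TY _ bounded_map_on_iterated_transpose(1), of m g x]
    pairing_level_transpose[OF TY TX _ bounded_map_on_iterated_transpose(2), of m x g]
  by (simp_all add: odd_transpose.simps(1))

end
section \<open>Functoriality of iterated transposition\<close>

text \<open>
  Iterated transposition is a functor, covariant at even and contravariant at odd levels. At level
  0 this is the hypothesis on \<open>\<theta>\<close>; each later level follows from the one below it, because an
  element of a dual level is determined by its pairings with the level below.
\<close>
lemma iterated_transpose_comp:
  assumes TX: "dual_tower N sX TX" and TY: "dual_tower N sY TY" and TZ: "dual_tower N sZ TZ"
    and \<phi>: "bounded_hom sX sY \<phi>" and \<psi>: "bounded_hom sY sZ \<psi>"
    and \<theta>: "bounded_hom sX sZ \<theta>" "\<And>x. \<theta> x = \<psi> (\<phi> x)"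
  shows even_transpose_comp: "2 * m \<le> N \<Longrightarrow> x \<in> lev TX (2 * m) \<Longrightarrow>
      even_transpose TX TZ \<theta> m x = even_transpose TY TZ \<psi> m (even_transpose TX TY \<phi> m x)"
    and odd_transpose_comp: "2 * m < N \<Longrightarrow> g \<in> lev TZ (Suc (2 * m)) \<Longrightarrow>
      odd_transpose TX TZ \<theta> m g = odd_transpose TX TY \<phi> m (odd_transpose TY TZ \<psi> m g)"
proof -
  note mem = iterated_transpose_mem[OF TX TY \<phi>] iterated_transpose_mem[OF TY TZ \<psi>]
    iterated_transpose_mem[OF TX TZ \<theta>(1)]
  note pairing = pairing_iterated_transpose[OF TX TY \<phi>] pairing_iterated_transpose[OF TY TZ \<psi>]
    pairing_iterated_transpose[OF TX TZ \<theta>(1)]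
  have odd: "odd_transpose TX TZ \<theta> m g = odd_transpose TX TY \<phi> m (odd_transpose TY TZ \<psi> m g)"
    if even: "\<And>x. x \<in> lev TX (2 * m) \<Longrightarrow>
        even_transpose TX TZ \<theta> m x = even_transpose TY TZ \<psi> m (even_transpose TX TY \<phi> m x)"
      and "2 * m < N" "g \<in> lev TZ (Suc (2 * m))" for m g
    using that by (intro lev_eqI[OF TX, of "2 * m"]) (simp_all add: mem pairing)
  have even: "even_transpose TX TZ \<theta> m x = even_transpose TY TZ \<psi> m (even_transpose TX TY \<phi> m x)"
    if "2 * m \<le> N" "x \<in> lev TX (2 * m)" for m x
    using that
  proof (induction m arbitrary: x)
    case 0
    then show ?case
      by (auto simp: lev_0[OF TX] inv_base[OF TX] inv_base[OF TY] \<theta>)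
  next
    case (Suc m)
    \<comment> \<open>The membership facts with their index in the simplifier's normal form of \<open>2 * Suc m\<close>.\<close>
    note mem_Suc = mem(1,3,5)[of "Suc m", simplified mult_Suc_right add_2_eq_Suc]
    from Suc have "2 * m \<le> N" by simp
    note odd' = odd[of m, OF Suc.IH[OF this]]
    show ?case
      using Suc.prems
      by (intro lev_eqI[OF TZ, of "Suc (2 * m)"])
        (simp_all add: mem mem_Suc pairing odd' del: even_transpose.simps)
  qed
  show "2 * m \<le> N \<Longrightarrow> x \<in> lev TX (2 * m) \<Longrightarrow>
      even_transpose TX TZ \<theta> m x = even_transpose TY TZ \<psi> m (even_transpose TX TY \<phi> m x)"
    by (rule even)
  show "2 * m < N \<Longrightarrow> g \<in> lev TZ (Suc (2 * m)) \<Longrightarrow>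
      odd_transpose TX TZ \<theta> m g = odd_transpose TX TY \<phi> m (odd_transpose TY TZ \<psi> m g)"
    by (rule odd) (auto intro: even)
qed

text \<open>
  The functor is additive, by the same passage from each level to the next.
\<close>
lemma iterated_transpose_sum:
  assumes TX: "dual_tower N sX TX" and TY: "dual_tower N sY TY"
    and \<phi>: "bounded_hom sX sY \<phi>" and \<psi>: "bounded_hom sX sY \<psi>"
    and \<theta>: "bounded_hom sX sY \<theta>" "\<And>x. \<theta> x = \<phi> x + \<psi> x"
  shows even_transpose_sum: "2 * m \<le> N \<Longrightarrow> x \<in> lev TX (2 * m) \<Longrightarrow>
      even_transpose TX TY \<theta> m x = even_transpose TX TY \<phi> m x + even_transpose TX TY \<psi> m x"
    and odd_transpose_sum: "2 * m < N \<Longrightarrow> g \<in> lev TY (Suc (2 * m)) \<Longrightarrow>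
      odd_transpose TX TY \<theta> m g = odd_transpose TX TY \<phi> m g + odd_transpose TX TY \<psi> m g"
proof -
  note mem = iterated_transpose_mem[OF TX TY \<phi>] iterated_transpose_mem[OF TX TY \<psi>]
    iterated_transpose_mem[OF TX TY \<theta>(1)]
  note pairing = pairing_iterated_transpose[OF TX TY \<phi>] pairing_iterated_transpose[OF TX TY \<psi>]
    pairing_iterated_transpose[OF TX TY \<theta>(1)]
  note closed = lev_closed[OF TX] lev_closed[OF TY]
  have odd: "odd_transpose TX TY \<theta> m g = odd_transpose TX TY \<phi> m g + odd_transpose TX TY \<psi> m g"
    if even: "\<And>x. x \<in> lev TX (2 * m) \<Longrightarrow>
        even_transpose TX TY \<theta> m x = even_transpose TX TY \<phi> m x + even_transpose TX TY \<psi> m x"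
      and "2 * m < N" "g \<in> lev TY (Suc (2 * m))" for m g
    using that
    by (intro lev_eqI[OF TX, of "2 * m"])
      (simp_all add: mem pairing closed pairing_left[OF TX] pairing_right[OF TY])
  have even: "even_transpose TX TY \<theta> m x = even_transpose TX TY \<phi> m x + even_transpose TX TY \<psi> m x"
    if "2 * m \<le> N" "x \<in> lev TX (2 * m)" for m x
    using that
  proof (induction m arbitrary: x)
    case 0
    then show ?case
      by (auto simp: lev_0[OF TX] inv_base[OF TX] \<theta> base_linear[OF TY])
  next
    case (Suc m)
    note mem_Suc = mem(1,3,5)[of "Suc m", simplified mult_Suc_right add_2_eq_Suc]
    from Suc have "2 * m \<le> N" by simp
    note odd' = odd[of m, OF Suc.IH[OF this]]
    show ?case
      using Suc.prems
      by (intro lev_eqI[OF TY, of "Suc (2 * m)"])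
        (simp_all add: mem mem_Suc pairing odd' closed pairing_left[OF TY] pairing_right[OF TX]
          del: even_transpose.simps)
  qed
  show "2 * m \<le> N \<Longrightarrow> x \<in> lev TX (2 * m) \<Longrightarrow>
      even_transpose TX TY \<theta> m x = even_transpose TX TY \<phi> m x + even_transpose TX TY \<psi> m x"
    by (rule even)
  show "2 * m < N \<Longrightarrow> g \<in> lev TY (Suc (2 * m)) \<Longrightarrow>
      odd_transpose TX TY \<theta> m g = odd_transpose TX TY \<phi> m g + odd_transpose TX TY \<psi> m g"
    by (rule odd) (auto intro: even)
qed

lemma iterated_transpose_id:
  assumes TX: "dual_tower N sX TX" and \<phi>: "bounded_hom sX sX \<phi>" "\<And>x. \<phi> x = x"
  shows even_transpose_id: "2 * m \<le> N \<Longrightarrow> x \<in> lev TX (2 * m) \<Longrightarrow> even_transpose TX TX \<phi> m x = x"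
    and odd_transpose_id: "2 * m < N \<Longrightarrow> g \<in> lev TX (Suc (2 * m)) \<Longrightarrow> odd_transpose TX TX \<phi> m g = g"
proof -
  note mem = iterated_transpose_mem[OF TX TX \<phi>(1)]
  note pairing = pairing_iterated_transpose[OF TX TX \<phi>(1)]
  have odd: "odd_transpose TX TX \<phi> m g = g"
    if even: "\<And>x. x \<in> lev TX (2 * m) \<Longrightarrow> even_transpose TX TX \<phi> m x = x"
      and "2 * m < N" "g \<in> lev TX (Suc (2 * m))" for m g
    using that by (intro lev_eqI[OF TX, of "2 * m"]) (simp_all add: mem pairing)
  have even: "even_transpose TX TX \<phi> m x = x"
    if "2 * m \<le> N" "x \<in> lev TX (2 * m)" for m x
    using that
  proof (induction m arbitrary: x)
    case 0
    then show ?case by (auto simp: lev_0[OF TX] inv_base[OF TX] \<phi>)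
  next
    case (Suc m)
    note mem_Suc = mem(1)[of "Suc m", simplified mult_Suc_right add_2_eq_Suc]
    from Suc have "2 * m \<le> N" by simp
    note odd' = odd[of m, OF Suc.IH[OF this]]
    show ?case
      using Suc.prems
      by (intro lev_eqI[OF TX, of "Suc (2 * m)"])
        (simp_all add: mem mem_Suc pairing odd' del: even_transpose.simps)
  qed
  show "2 * m \<le> N \<Longrightarrow> x \<in> lev TX (2 * m) \<Longrightarrow> even_transpose TX TX \<phi> m x = x"
    by (rule even)
  show "2 * m < N \<Longrightarrow> g \<in> lev TX (Suc (2 * m)) \<Longrightarrow> odd_transpose TX TX \<phi> m g = g"
    by (rule odd) (auto intro: even)
qed

text \<open>
  Additivity applied to \<open>0 + 0 = 0\<close>.
\<close>
lemma odd_transpose_zero: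
  assumes TX: "dual_tower N sX TX" and TY: "dual_tower N sY TY"
    and \<phi>: "bounded_hom sX sY \<phi>" "\<And>x. \<phi> x = 0"
    and "2 * m < N" "g \<in> lev TY (Suc (2 * m))"
  shows "odd_transpose TX TY \<phi> m g = 0"
  using odd_transpose_sum[OF TX TY \<phi>(1) \<phi>(1) \<phi>(1) _ assms(5,6)] \<phi>(2) by simp

section \<open>The dual actions as iterated transposes\<close>

text \<open>
  The left action on a dual transposes the right action on the predual and conversely. Hence at even
  levels an action by \<open>c\<close> comes from multiplication by \<open>c\<close> on the same side, and at odd levels from
  multiplication on the opposite side. Identities between actions on duals thereby become
  identities between bounded maps on the undualized spaces.
\<close>
lemma actions_eq_iterated_transpose:
  shows "lact T l r (2 * m) c = even_transpose T T (\<lambda>x. l c x) m"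
    and "(\<lambda>x. ract T l r (2 * m) x c) = even_transpose T T (\<lambda>x. r x c) m"
    and lact_odd: "lact T l r (2 * m + 1) c = odd_transpose T T (\<lambda>x. r x c) m"
    and ract_odd: "ract T l r (2 * m + 1) x c = odd_transpose T T (\<lambda>x. l c x) m x"
proof -
  have odd: "lact T l r (2 * m + 1) c = odd_transpose T T (\<lambda>x. r x c) m"
      "(\<lambda>x. ract T l r (2 * m + 1) x c) = odd_transpose T T (\<lambda>x. l c x) m"
    if "lact T l r (2 * m) c = even_transpose T T (\<lambda>x. l c x) m"
       "(\<lambda>x. ract T l r (2 * m) x c) = even_transpose T T (\<lambda>x. r x c) m" for m
    using that fun_cong[OF that(2)] by (auto simp: odd_transpose.simps level_transpose_def)
  have even: "lact T l r (2 * m) c = even_transpose T T (\<lambda>x. l c x) m \<and>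
    (\<lambda>x. ract T l r (2 * m) x c) = even_transpose T T (\<lambda>x. r x c) m"
  proof (induction m)
    case 0
    then show ?case by auto
  next
    case (Suc m)
    then show ?case
      using odd[of m] fun_cong[OF odd(2)[of m]] by (auto simp: level_transpose_def simp del: lact.simps(1) ract.simps(1) )
  qed
  then show "lact T l r (2 * m) c = even_transpose T T (\<lambda>x. l c x) m"
    "(\<lambda>x. ract T l r (2 * m) x c) = even_transpose T T (\<lambda>x. r x c) m"
    by auto
  from odd[OF this] show "lact T l r (2 * m + 1) c = odd_transpose T T (\<lambda>x. r x c) m"
    "ract T l r (2 * m + 1) x c = odd_transpose T T (\<lambda>x. l c x) m x"
    by (auto dest: fun_cong)
qed

text \<open>
  The mixed operations have the same form; here the map that is transposed sends \<open>\<beta>\<close> to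
  \<open>\<beta> \<cdot> a\<close> or \<open>a \<cdot> \<beta>\<close>, with \<open>a\<close> fixed and the argument ranging over the acting algebra.
\<close>
lemma mixed_even_eq_transpose:
  "mixl_even TA TB l r m a = even_transpose TB TA (r a) m"
  "(\<lambda>y. mixr_even TA TB l r m y a) = even_transpose TB TA (\<lambda>\<beta>. l \<beta> a) m"
proof (induction m)
  case (Suc m)
  note IH = Suc.IH fun_cong[OF Suc.IH(2)]
  case 1 show ?case using IH by (simp add: level_transpose_def odd_transpose.simps fun_eq_iff)
  case 2 show ?case using IH by (simp add: level_transpose_def odd_transpose.simps fun_eq_iff)
qed auto

lemma mixl_odd_eq_transpose: "mixl_odd TA TB l r m a = odd_transpose TB TA (\<lambda>\<beta>. l \<beta> a) m"
  using mixed_even_eq_transpose(2)[of TA TB l r m a]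
  by (auto simp: level_transpose_def odd_transpose.simps fun_eq_iff)

lemma mixr_odd_eq_transpose: "mixr_odd TA TB l r m x a = odd_transpose TB TA (\<lambda>\<beta>. r a \<beta>) m x"
  using mixed_even_eq_transpose(1)[of TA TB l r m a]
  by (auto simp: level_transpose_def odd_transpose.simps fun_eq_iff)

section \<open>Bounded linear maps\<close>

lemma bounded_linear_intoD:
  assumes "bounded_linear_into s sU X D"
  shows "D c \<in> X" "D (c + d) = D c + D d" "D 0 = 0"
  using assms linear_0 bounded_linear.linear
  by (auto simp: bounded_linear_into_def Vector_Spaces.linear_iff)

lemma bounded_linear_into_comp:
  assumes "bounded_linear_into s s' X \<phi>" "bounded_linear_into s' sU Y D"
  shows "bounded_linear_into s sU Y (\<lambda>c. D (\<phi> c))"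
  using assms bounded_linear_compose[of D \<phi>]
  by (auto simp: bounded_linear_into_def Vector_Spaces.linear_iff)

lemma bounded_linear_into_add:
  assumes "bounded_linear_into s sU X D" "bounded_linear_into s sU X E"
    and "\<And>x y. x \<in> X \<Longrightarrow> y \<in> X \<Longrightarrow> x + y \<in> X"
  shows "bounded_linear_into s sU X (\<lambda>c. D c + E c)"
  using assms bounded_linear_add[of D E] bounded_linear_intoD(1)[OF assms(1)] bounded_linear_intoD(1)[OF assms(2)]
  by (auto simp: bounded_linear_into_def Vector_Spaces.linear_iff vector_space.vector_space_assms)

lemma bounded_linear_into_bounded_map_on:
  assumes sU: "normed_space_over sU" and sV: "normed_space_over sV"
    and S: "bounded_map_on sU sV X Y S" and D: "bounded_linear_into s sU X D"
  shows "bounded_linear_into s sV Y (\<lambda>c. S (D c))"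
proof -
  interpret U: normed_space_over sU by fact
  interpret V: normed_space_over sV by fact
  have D': "bounded_linear D" "\<And>c. D c \<in> X"
    using D by (auto simp: bounded_linear_into_def)
  interpret D: bounded_linear D by fact
  obtain K where K: "\<And>c. norm (D c) \<le> norm c * K" "K \<ge> 0"
    using D.nonneg_bounded by blast
  obtain L where L: "\<And>x. x \<in> X \<Longrightarrow> norm (S x) \<le> L * norm x"
    using S unfolding bounded_map_on_def by blast
  have "bounded_linear (\<lambda>c. S (D c))"
  proof (rule bounded_linear_intro)
    fix c d and t :: real
    show "S (D (c + d)) = S (D c) + S (D d)"
      using S D' by (simp add: bounded_map_on_def D.add)
    \<comment> \<open>\<open>S\<close> is homogeneous over the given field; real scalars are reached through \<open>of_real\<close>.\<close>
    have "S (D (t *\<^sub>R c)) = S (sU (of_real t) (D c))"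
      by (simp add: D.scaleR U.scale_of_real)
    also have "\<dots> = t *\<^sub>R S (D c)"
      using S D' by (simp add: bounded_map_on_def V.scale_of_real)
    finally show "S (D (t *\<^sub>R c)) = t *\<^sub>R S (D c)" .
    have "norm (S (D c)) \<le> \<bar>L\<bar> * norm (D c)"
      using L[OF D'(2)[of c]] by (rule order.trans) (simp add: mult_right_mono)
    also have "\<dots> \<le> \<bar>L\<bar> * (norm c * K)"
      by (intro mult_left_mono K) simp
    finally show "norm (S (D c)) \<le> norm c * (\<bar>L\<bar> * K)"
      by (simp add: ac_simps)
  qed
  moreover have "S (D c) \<in> Y" "S (D (c + d)) = S (D c) + S (D d)" "S (D (s t c)) = sV t (S (D c))" for c d t
    using S D D' by (auto simp: bounded_map_on_def bounded_linear_into_def Vector_Spaces.linear_iff)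
  ultimately show ?thesis
    using D V.vector_space_axioms
    by (auto simp: bounded_linear_into_def Vector_Spaces.linear_iff)
qed

lemma bounded_hom_id: "normed_space_over s \<Longrightarrow> bounded_hom s s (\<lambda>x. x)"
  by (simp add: bounded_linear_into_def Vector_Spaces.linear_iff normed_space_over_def bounded_linear_ident)

lemma bounded_hom_zero:
  assumes "normed_space_over s" "normed_space_over s'"
  shows "bounded_hom s s' (\<lambda>x. 0)"
proof -
  interpret normed_space_over s' by fact
  show ?thesis
    using assms by (simp add: bounded_linear_into_def Vector_Spaces.linear_iff normed_space_over_def)
qed

lemma bounded_hom_mult:
  assumes "banach_algebra_over s"
  shows "bounded_hom s s (\<lambda>x. a * x)" "bounded_hom s s (\<lambda>x. x * a)"
proof -
  interpret banach_algebra_over s by fact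
  show "bounded_hom s s (\<lambda>x. a * x)" "bounded_hom s s (\<lambda>x. x * a)"
    by (auto simp: bounded_linear_into_def Vector_Spaces.linear_iff vector_space_axioms
        bounded_linear_mult_left bounded_linear_mult_right algebra_simps
        simp flip: scale_mult_left scale_mult_right)
qed

lemma bounded_hom_action:
  assumes "banach_bimodule_over sB sA l r"
  shows "bounded_hom sA sA (\<lambda>a. l \<beta> a)" "bounded_hom sA sA (\<lambda>a. r a \<beta>)"
    and "bounded_hom sB sA (\<lambda>\<beta>. l \<beta> a)" "bounded_hom sB sA (\<lambda>\<beta>. r a \<beta>)"
proof -
  interpret banach_bimodule_over sB sA l r by fact
  interpret l: bounded_bilinear l by (rule bounded_bilinear_left)
  interpret r: bounded_bilinear r by (rule bounded_bilinear_right)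
  show "bounded_hom sA sA (\<lambda>a. l \<beta> a)" "bounded_hom sA sA (\<lambda>a. r a \<beta>)"
    "bounded_hom sB sA (\<lambda>\<beta>. l \<beta> a)" "bounded_hom sB sA (\<lambda>\<beta>. r a \<beta>)"
    by (auto simp: bounded_linear_into_def Vector_Spaces.linear_iff
        alg.vector_space_axioms space.vector_space_axioms
        l.bounded_linear_left l.bounded_linear_right r.bounded_linear_left r.bounded_linear_right
        l.add_left l.add_right r.add_left r.add_right
        left_scale1 left_scale2 right_scale1 right_scale2)
qed

lemma vector_space_dup_scale:
  assumes "vector_space sA" "vector_space sB"
  shows "vector_space (dup_scale sA sB)"
proof -
  interpret A: vector_space sA by fact
  interpret B: vector_space sB by fact
  show ?thesis
    by standard (simp_all add: dup_scale_def plus_dup_def A.scale_right_distrib A.scale_left_distrib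
        B.scale_right_distrib B.scale_left_distrib dup.expand)
qed

lemma bounded_hom_dup:
  assumes "vector_space sA" "vector_space sB"
  shows "bounded_hom (dup_scale sA sB) sA dfst" "bounded_hom (dup_scale sA sB) sB dsnd"
  unfolding bounded_linear_into_def Vector_Spaces.linear_iff
  using assms vector_space_dup_scale[OF assms]
  by (auto intro!: bounded_linear_intro[where K = 1]
      simp: plus_dup_def scaleR_dup_def norm_dup_def dup_scale_def)

lemma bounded_hom_Dup:
  assumes f: "bounded_hom s sA f" and g: "bounded_hom s sB g"
  shows "bounded_hom s (dup_scale sA sB) (\<lambda>x. Dup (f x) (g x))"
proof -
  have fg: "bounded_linear f" "bounded_linear g"
    using f g by (auto simp: bounded_linear_into_def)
  interpret f: bounded_linear f by fact
  interpret g: bounded_linear g by fact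
  obtain K L where K: "\<And>x. norm (f x) \<le> norm x * K" and L: "\<And>x. norm (g x) \<le> norm x * L"
    using f.bounded g.bounded by blast
  have "bounded_linear (\<lambda>x. Dup (f x) (g x))"
    using K L
    by (intro bounded_linear_intro[where K = "K + L"])
      (auto simp: plus_dup_def scaleR_dup_def norm_dup_def f.add g.add f.scaleR g.scaleR
        distrib_left intro!: add_mono)
  then show ?thesis
    using f g vector_space_dup_scale[of sA sB]
    by (auto simp: bounded_linear_into_def Vector_Spaces.linear_iff plus_dup_def dup_scale_def)
qed

section \<open>Transport of derivations along homomorphisms\<close>

lemma lev_diff:
  assumes "dual_tower N s T" "k \<le> N" "x \<in> lev T k" "y \<in> lev T k"
  shows "x - y \<in> lev T k"
proof -
  have "x + uscale T (of_real (- 1)) y \<in> lev T k"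
    using assms by (intro lev_closed[OF assms(1)])
  then show ?thesis unfolding tower_scaleR[OF assms(1)] by simp
qed

context
  fixes N n :: nat
    and sC :: "'k::real_normed_field \<Rightarrow> 'c::real_normed_vector \<Rightarrow> 'c"
    and sE :: "'k \<Rightarrow> 'e::real_normed_vector \<Rightarrow> 'e"
    and TC :: "('k, 'c, 'u::real_normed_vector) tower"
    and TE :: "('k, 'e, 'v::real_normed_vector) tower"
    and mulC :: "'c \<Rightarrow> 'c \<Rightarrow> 'c" and mulE :: "'e \<Rightarrow> 'e \<Rightarrow> 'e"
    and \<phi> :: "'c \<Rightarrow> 'e"
  assumes TC: "dual_tower N sC TC" and TE: "dual_tower N sE TE" and n: "2 * n < N"
    and mulC: "\<And>c. bounded_hom sC sC (\<lambda>x. mulC c x)" "\<And>c. bounded_hom sC sC (\<lambda>x. mulC x c)"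
    and mulE: "\<And>e. bounded_hom sE sE (\<lambda>x. mulE e x)" "\<And>e. bounded_hom sE sE (\<lambda>x. mulE x e)"
    and \<phi>: "bounded_hom sC sE \<phi>" and \<phi>_mult: "\<And>c d. \<phi> (mulC c d) = mulE (\<phi> c) (\<phi> d)"
begin

text \<open>
  Multiplicativity of \<open>\<phi>\<close> says that \<open>\<phi>\<close> intertwines multiplication by \<open>c\<close> with multiplication
  by \<open>\<phi> c\<close>, on either side. Transposing these two commuting squares shows that the transpose of
  \<open>\<phi>\<close> at an odd level is a homomorphism of bimodules, where \<open>c\<close> acts on the source through
  \<open>\<phi>\<close>.
\<close>
lemma odd_transpose_action:
  assumes y: "y \<in> lev TE (2 * n + 1)"
  shows "odd_transpose TC TE \<phi> n (lact TE mulE mulE (2 * n + 1) (\<phi> c) y)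
      = lact TC mulC mulC (2 * n + 1) c (odd_transpose TC TE \<phi> n y)"
    and "odd_transpose TC TE \<phi> n (ract TE mulE mulE (2 * n + 1) y (\<phi> c))
      = ract TC mulC mulC (2 * n + 1) (odd_transpose TC TE \<phi> n y) c"
proof -
  have y: "y \<in> lev TE (Suc (2 * n))" using y by simp
  have "odd_transpose TC TE \<phi> n (odd_transpose TE TE (\<lambda>x. mulE x (\<phi> c)) n y)
      = odd_transpose TC TE (\<lambda>x. mulE (\<phi> x) (\<phi> c)) n y"
    using odd_transpose_comp[OF TC TE TE \<phi> mulE(2) bounded_linear_into_comp[OF \<phi> mulE(2)] refl n y]
    by simp
  also have "\<dots> = odd_transpose TC TC (\<lambda>x. mulC x c) n (odd_transpose TC TE \<phi> n y)"
    using odd_transpose_comp[OF TC TC TE mulC(2) \<phi> bounded_linear_into_comp[OF \<phi> mulE(2)] _ n y]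
    by (simp add: \<phi>_mult)
  finally show "odd_transpose TC TE \<phi> n (lact TE mulE mulE (2 * n + 1) (\<phi> c) y)
      = lact TC mulC mulC (2 * n + 1) c (odd_transpose TC TE \<phi> n y)"
    unfolding lact_odd .
  have "odd_transpose TC TE \<phi> n (odd_transpose TE TE (\<lambda>x. mulE (\<phi> c) x) n y)
      = odd_transpose TC TE (\<lambda>x. mulE (\<phi> c) (\<phi> x)) n y"
    using odd_transpose_comp[OF TC TE TE \<phi> mulE(1) bounded_linear_into_comp[OF \<phi> mulE(1)] refl n y]
    by simp
  also have "\<dots> = odd_transpose TC TC (\<lambda>x. mulC c x) n (odd_transpose TC TE \<phi> n y)"
    using odd_transpose_comp[OF TC TC TE mulC(1) \<phi> bounded_linear_into_comp[OF \<phi> mulE(1)] _ n y]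
    by (simp add: \<phi>_mult)
  finally show "odd_transpose TC TE \<phi> n (ract TE mulE mulE (2 * n + 1) y (\<phi> c))
      = ract TC mulC mulC (2 * n + 1) (odd_transpose TC TE \<phi> n y) c"
    unfolding ract_odd .
qed

lemma odd_actions_mem:
  assumes "y \<in> lev TE (2 * n + 1)"
  shows "lact TE mulE mulE (2 * n + 1) e y \<in> lev TE (2 * n + 1)"
    and "ract TE mulE mulE (2 * n + 1) y e \<in> lev TE (2 * n + 1)"
  using assms iterated_transpose_mem(2)[OF TE TE mulE(1) n] iterated_transpose_mem(2)[OF TE TE mulE(2) n]
  unfolding lact_odd ract_odd by simp_all

text \<open>
  A derivation may be precomposed with a homomorphism and postcomposed with a bimodule homomorphism.
  The homomorphism \<open>\<phi>\<close> supplies both, since its transpose runs in the opposite direction.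
\<close>
lemma derivation_pullback:
  assumes D: "derivation sE mulE (uscale TE) (lev TE (2 * n + 1))
      (lact TE mulE mulE (2 * n + 1)) (ract TE mulE mulE (2 * n + 1)) D"
  shows "derivation sC mulC (uscale TC) (lev TC (2 * n + 1))
      (lact TC mulC mulC (2 * n + 1)) (ract TC mulC mulC (2 * n + 1))
      (\<lambda>c. odd_transpose TC TE \<phi> n (D (\<phi> c)))"
proof -
  have D': "bounded_linear_into sE (uscale TE) (lev TE (2 * n + 1)) D"
    and D_mult: "D (mulE c d) = ract TE mulE mulE (2 * n + 1) (D c) d + lact TE mulE mulE (2 * n + 1) c (D d)"
      for c d
    using D unfolding derivation_def by blast+
  note D_mem = bounded_linear_intoD(1)[OF D']
  show ?thesis
    unfolding derivation_def
  proof (intro conjI allI)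
    show "bounded_linear_into sC (uscale TC) (lev TC (2 * n + 1)) (\<lambda>c. odd_transpose TC TE \<phi> n (D (\<phi> c)))"
      using bounded_linear_into_bounded_map_on[OF tower_normed_space[OF TE] tower_normed_space[OF TC]
          bounded_map_on_iterated_transpose(2)[OF TC TE \<phi> n] bounded_linear_into_comp[OF \<phi> D']] .
    fix c d
    show "odd_transpose TC TE \<phi> n (D (\<phi> (mulC c d)))
      = ract TC mulC mulC (2 * n + 1) (odd_transpose TC TE \<phi> n (D (\<phi> c))) d
        + lact TC mulC mulC (2 * n + 1) c (odd_transpose TC TE \<phi> n (D (\<phi> d)))"
      unfolding \<phi>_mult D_mult odd_transpose_action[OF D_mem, symmetric]
      using odd_actions_mem D_mem by (intro odd_transpose_add[OF TC TE \<phi> n]) simp_all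
  qed
qed

lemma inner_derivation_pullback:
  assumes "inner_derivation (lev TE (2 * n + 1))
      (lact TE mulE mulE (2 * n + 1)) (ract TE mulE mulE (2 * n + 1)) D"
  shows "inner_derivation (lev TC (2 * n + 1))
      (lact TC mulC mulC (2 * n + 1)) (ract TC mulC mulC (2 * n + 1))
      (\<lambda>c. odd_transpose TC TE \<phi> n (D (\<phi> c)))"
proof -
  obtain y where y: "y \<in> lev TE (2 * n + 1)"
    and D: "\<And>e. D e = lact TE mulE mulE (2 * n + 1) e y - ract TE mulE mulE (2 * n + 1) y e"
    using assms unfolding inner_derivation_def by blast
  let ?F = "odd_transpose TC TE \<phi> n"
  have diff: "?F (f - g) = ?F f - ?F g"
    if "f \<in> lev TE (2 * n + 1)" "g \<in> lev TE (2 * n + 1)" for f g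
    using odd_transpose_add[OF TC TE \<phi> n, of "f - g" g] that lev_diff[OF TE _ that] n
    by (simp add: algebra_simps)
  show ?thesis
    unfolding inner_derivation_def
  proof (intro bexI[of _ "?F y"] allI)
    show "?F y \<in> lev TC (2 * n + 1)"
      using iterated_transpose_mem(2)[OF TC TE \<phi> n] y by simp
    fix c
    show "?F (D (\<phi> c)) = lact TC mulC mulC (2 * n + 1) c (?F y) - ract TC mulC mulC (2 * n + 1) (?F y) c"
      unfolding D diff[OF odd_actions_mem[OF y]] odd_transpose_action[OF y] ..
  qed
qed

end

text \<open>
  A derivation \<open>D\<close> of \<open>E\<close> is pulled back along \<open>\<pi>\<close> to one of \<open>C\<close>, which is inner by
  hypothesis. Pulling back once more along \<open>\<iota>\<close> preserves innerness and returns \<open>D\<close>, because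
  \<open>\<pi> \<circ> \<iota>\<close> is the identity and so is its transpose. The argument needs odd levels: only there
  does transposition reverse the direction of \<open>\<pi>\<close> and \<open>\<iota>\<close>.
\<close>
lemma weakly_amenable_retract:
  fixes \<pi> :: "'c::real_normed_vector \<Rightarrow> 'e::real_normed_vector"
  assumes TC: "dual_tower N sC TC" and TE: "dual_tower N sE TE" and n: "2 * n < N"
    and mulC: "\<And>c. bounded_hom sC sC (\<lambda>x. mulC c x)" "\<And>c. bounded_hom sC sC (\<lambda>x. mulC x c)"
    and mulE: "\<And>e. bounded_hom sE sE (\<lambda>x. mulE e x)" "\<And>e. bounded_hom sE sE (\<lambda>x. mulE x e)"
    and \<pi>: "bounded_hom sC sE \<pi>" "\<And>c d. \<pi> (mulC c d) = mulE (\<pi> c) (\<pi> d)"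
    and \<iota>: "bounded_hom sE sC \<iota>" "\<And>e f. \<iota> (mulE e f) = mulC (\<iota> e) (\<iota> f)"
    and retract: "\<And>e. \<pi> (\<iota> e) = e"
    and wa: "weakly_amenable (2 * n + 1) sC mulC TC"
  shows "weakly_amenable (2 * n + 1) sE mulE TE"
  unfolding weakly_amenable_def
proof (intro allI impI)
  fix D
  assume D: "derivation sE mulE (uscale TE) (lev TE (2 * n + 1))
      (lact TE mulE mulE (2 * n + 1)) (ract TE mulE mulE (2 * n + 1)) D"
  then have D_mem: "D e \<in> lev TE (Suc (2 * n))" for e
    using bounded_linear_intoD(1) unfolding derivation_def by fastforce
  define D' where "D' c = odd_transpose TC TE \<pi> n (D (\<pi> c))" for c
  have "inner_derivation (lev TC (2 * n + 1))
      (lact TC mulC mulC (2 * n + 1)) (ract TC mulC mulC (2 * n + 1)) D'"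
    using wa derivation_pullback[OF TC TE n mulC mulE \<pi> D]
    unfolding weakly_amenable_def D'_def by blast
  note inner_derivation_pullback[OF TE TC n mulE mulC \<iota> this]
  moreover have "odd_transpose TE TC \<iota> n (D' (\<iota> e)) = D e" for e
  proof -
    have id: "bounded_hom sE sE (\<lambda>x. \<pi> (\<iota> x))"
      by (rule bounded_linear_into_comp[OF \<iota>(1) \<pi>(1)])
    show ?thesis
      using odd_transpose_comp[OF TE TC TE \<iota>(1) \<pi>(1) id refl n D_mem[of e]]
        odd_transpose_id[OF TE id retract n D_mem[of e]]
      by (simp add: D'_def retract)
  qed
  ultimately show "inner_derivation (lev TE (2 * n + 1))
      (lact TE mulE mulE (2 * n + 1)) (ract TE mulE mulE (2 * n + 1)) D"
    by simp
qed

section \<open>The amalgamated duplication\<close>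

lemma bounded_hom_dup_mult:
  assumes A: "banach_algebra_over sA" and B: "banach_algebra_over sB"
    and act: "banach_bimodule_over sB sA l r"
  shows "bounded_hom (dup_scale sA sB) (dup_scale sA sB) (\<lambda>x. dup_mult l r c x)"
    and "bounded_hom (dup_scale sA sB) (dup_scale sA sB) (\<lambda>x. dup_mult l r x c)"
proof -
  have vs: "vector_space sA" "vector_space sB"
    using A B by (simp_all add: banach_algebra_over_def normed_space_over_def)
  note fst = bounded_linear_into_comp[OF bounded_hom_dup(1)[OF vs]]
    and snd = bounded_linear_into_comp[OF bounded_hom_dup(2)[OF vs]]
  show "bounded_hom (dup_scale sA sB) (dup_scale sA sB) (\<lambda>x. dup_mult l r c x)"
    unfolding dup_mult_def
    by (intro bounded_hom_Dup bounded_linear_into_add UNIV_I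
        fst[OF bounded_hom_mult(1)[OF A]] snd[OF bounded_hom_mult(1)[OF B]]
        fst[OF bounded_hom_action(1)[OF act]] snd[OF bounded_hom_action(4)[OF act]])
  show "bounded_hom (dup_scale sA sB) (dup_scale sA sB) (\<lambda>x. dup_mult l r x c)"
    unfolding dup_mult_def
    by (intro bounded_hom_Dup bounded_linear_into_add UNIV_I
        fst[OF bounded_hom_mult(2)[OF A]] snd[OF bounded_hom_mult(2)[OF B]]
        fst[OF bounded_hom_action(2)[OF act]] snd[OF bounded_hom_action(3)[OF act]])
qed

context
  fixes sA :: "'k::real_normed_field \<Rightarrow> 'a::{real_normed_algebra,banach} \<Rightarrow> 'a"
    and sB :: "'k \<Rightarrow> 'b::{real_normed_algebra,banach} \<Rightarrow> 'b"
    and l :: "'b \<Rightarrow> 'a \<Rightarrow> 'a" and r :: "'a \<Rightarrow> 'b \<Rightarrow> 'a"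
    and N n :: nat
    and TA :: "('k, 'a, 'u::real_normed_vector) tower"
    and TB :: "('k, 'b, 'v::real_normed_vector) tower"
    and TC :: "('k, ('a, 'b) dup, 'w::real_normed_vector) tower"
  assumes A: "banach_algebra_over sA" and B: "banach_algebra_over sB"
    and act: "banach_bimodule_over sB sA l r"
    and TA: "dual_tower N sA TA" and TB: "dual_tower N sB TB"
    and TC: "dual_tower N (dup_scale sA sB) TC" and n: "2 * n < N"
begin

lemma bounded_hom_proj:
  "bounded_hom (dup_scale sA sB) sA dfst" "bounded_hom (dup_scale sA sB) sB dsnd"
proof -
  have vs: "vector_space sA" "vector_space sB"
    using A B by (simp_all add: banach_algebra_over_def normed_space_over_def)
  show "bounded_hom (dup_scale sA sB) sA dfst" "bounded_hom (dup_scale sA sB) sB dsnd"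
    by (rule bounded_hom_dup[OF vs])+
qed

lemma bounded_hom_incl:
  "bounded_hom sA (dup_scale sA sB) (\<lambda>a. Dup a 0)" "bounded_hom sB (dup_scale sA sB) (\<lambda>\<beta>. Dup 0 \<beta>)"
  using A B by (auto simp: banach_algebra_over_def intro!: bounded_hom_Dup bounded_hom_id bounded_hom_zero)

lemma action_zero: "l 0 a = 0" "l \<beta> 0 = 0" "r 0 \<beta> = 0" "r a 0 = 0"
  using bounded_hom_action[OF act] bounded_linear_intoD(3) by fastforce+

text \<open>
  The projection \<open>dfst\<close> is not multiplicative in general: the first component of a product with
  \<open>Dup a \<beta>\<close> consists of a product with \<open>a\<close> and an action of \<open>\<beta>\<close>, both applied to the first
  component of the other factor, and of a term \<open>h\<close> that depends on its second component. The first
  two dualize to maps that factor through \<open>dfst\<close>; the third one factors through \<open>dsnd\<close> and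
  becomes the mixed operation.
\<close>
lemma odd_transpose_dfst_split:
  assumes x: "x \<in> lev TA (Suc (2 * n))"
    and M: "bounded_hom (dup_scale sA sB) (dup_scale sA sB) M"
    and f: "bounded_hom sA sA f" and g: "bounded_hom sA sA g" and h: "bounded_hom sB sA h"
    and dfst_M: "\<And>d. dfst (M d) = f (dfst d) + g (dfst d) + h (dsnd d)"
  shows "odd_transpose TC TC M n (odd_transpose TC TA dfst n x)
    = odd_transpose TC TA dfst n (odd_transpose TA TA f n x + odd_transpose TA TA g n x)
      + odd_transpose TC TB dsnd n (odd_transpose TB TA h n x)"
proof -
  note fst = bounded_linear_into_comp[OF bounded_hom_proj(1)]
    and snd = bounded_linear_into_comp[OF bounded_hom_proj(2)]
  note sum = bounded_linear_into_add[where X = UNIV, OF _ _ UNIV_I]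
  have "odd_transpose TC TC M n (odd_transpose TC TA dfst n x)
      = odd_transpose TC TA (\<lambda>d. dfst (M d)) n x"
    using odd_transpose_comp[OF TC TC TA M bounded_hom_proj(1)
        bounded_linear_into_comp[OF M bounded_hom_proj(1)] refl n x] by simp
  also have "\<dots> = odd_transpose TC TA (\<lambda>d. f (dfst d) + g (dfst d)) n x
      + odd_transpose TC TA (\<lambda>d. h (dsnd d)) n x"
    by (rule odd_transpose_sum[OF TC TA sum[OF fst[OF f] fst[OF g]] snd[OF h]
          bounded_linear_into_comp[OF M bounded_hom_proj(1)] dfst_M n x])
  also have "odd_transpose TC TA (\<lambda>d. f (dfst d) + g (dfst d)) n x
      = odd_transpose TC TA (\<lambda>d. f (dfst d)) n x + odd_transpose TC TA (\<lambda>d. g (dfst d)) n x"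
    by (rule odd_transpose_sum[OF TC TA fst[OF f] fst[OF g] sum[OF fst[OF f] fst[OF g]] refl n x])
  also have "odd_transpose TC TA (\<lambda>d. f (dfst d)) n x
      = odd_transpose TC TA dfst n (odd_transpose TA TA f n x)"
    by (rule odd_transpose_comp[OF TC TA TA bounded_hom_proj(1) f fst[OF f] refl n x])
  also have "odd_transpose TC TA (\<lambda>d. g (dfst d)) n x
      = odd_transpose TC TA dfst n (odd_transpose TA TA g n x)"
    by (rule odd_transpose_comp[OF TC TA TA bounded_hom_proj(1) g fst[OF g] refl n x])
  also have "odd_transpose TC TA dfst n (odd_transpose TA TA f n x)
      + odd_transpose TC TA dfst n (odd_transpose TA TA g n x)
      = odd_transpose TC TA dfst n (odd_transpose TA TA f n x + odd_transpose TA TA g n x)"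
    using iterated_transpose_mem(2)[OF TA TA f n x] iterated_transpose_mem(2)[OF TA TA g n x]
    by (rule odd_transpose_add[OF TC TA bounded_hom_proj(1) n, symmetric])
  also have "odd_transpose TC TA (\<lambda>d. h (dsnd d)) n x
      = odd_transpose TC TB dsnd n (odd_transpose TB TA h n x)"
    by (rule odd_transpose_comp[OF TC TB TA bounded_hom_proj(2) h snd[OF h] refl n x])
  finally show ?thesis .
qed

lemma dup_action_odd_transpose_dfst:
  assumes x: "x \<in> lev TA (2 * n + 1)"
  shows "lact TC (dup_mult l r) (dup_mult l r) (2 * n + 1) (Dup a \<beta>) (odd_transpose TC TA dfst n x)
    = odd_transpose TC TA dfst n (lact TA (*) (*) (2 * n + 1) a x + lact TA l r (2 * n + 1) \<beta> x)
      + odd_transpose TC TB dsnd n (mixl_odd TA TB l r n a x)"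
    and "ract TC (dup_mult l r) (dup_mult l r) (2 * n + 1) (odd_transpose TC TA dfst n x) (Dup a \<beta>)
    = odd_transpose TC TA dfst n (ract TA (*) (*) (2 * n + 1) x a + ract TA l r (2 * n + 1) x \<beta>)
      + odd_transpose TC TB dsnd n (mixr_odd TA TB l r n x a)"
proof -
  have x: "x \<in> lev TA (Suc (2 * n))" using x by simp
  show "lact TC (dup_mult l r) (dup_mult l r) (2 * n + 1) (Dup a \<beta>) (odd_transpose TC TA dfst n x)
    = odd_transpose TC TA dfst n (lact TA (*) (*) (2 * n + 1) a x + lact TA l r (2 * n + 1) \<beta> x)
      + odd_transpose TC TB dsnd n (mixl_odd TA TB l r n a x)"
    unfolding lact_odd mixl_odd_eq_transpose
    by (rule odd_transpose_dfst_split[OF x bounded_hom_dup_mult(2)[OF A B act]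
          bounded_hom_mult(2)[OF A] bounded_hom_action(2)[OF act] bounded_hom_action(3)[OF act]])
      (simp add: dup_mult_def)
  show "ract TC (dup_mult l r) (dup_mult l r) (2 * n + 1) (odd_transpose TC TA dfst n x) (Dup a \<beta>)
    = odd_transpose TC TA dfst n (ract TA (*) (*) (2 * n + 1) x a + ract TA l r (2 * n + 1) x \<beta>)
      + odd_transpose TC TB dsnd n (mixr_odd TA TB l r n x a)"
    unfolding ract_odd mixr_odd_eq_transpose
    by (rule odd_transpose_dfst_split[OF x bounded_hom_dup_mult(1)[OF A B act]
          bounded_hom_mult(1)[OF A] bounded_hom_action(1)[OF act] bounded_hom_action(4)[OF act]])
      (simp add: dup_mult_def)
qed

text \<open>
  In contrast to \<open>dfst\<close>, the projection \<open>dsnd\<close> is a homomorphism.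
\<close>
lemma dup_action_odd_transpose_dsnd:
  assumes y: "y \<in> lev TB (2 * n + 1)"
  shows "lact TC (dup_mult l r) (dup_mult l r) (2 * n + 1) (Dup a \<beta>) (odd_transpose TC TB dsnd n y)
    = odd_transpose TC TB dsnd n (lact TB (*) (*) (2 * n + 1) \<beta> y)"
    and "ract TC (dup_mult l r) (dup_mult l r) (2 * n + 1) (odd_transpose TC TB dsnd n y) (Dup a \<beta>)
    = odd_transpose TC TB dsnd n (ract TB (*) (*) (2 * n + 1) y \<beta>)"
proof -
  have "dsnd (dup_mult l r c d) = dsnd c * dsnd d" for c d
    by (simp add: dup_mult_def)
  note odd_transpose_action[where c = "Dup a \<beta>" and mulC = "dup_mult l r" and mulE = "(*)" and \<phi> = dsnd,
      OF TC TB n bounded_hom_dup_mult[OF A B act] bounded_hom_mult[OF B]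
      bounded_hom_proj(2) this y, unfolded dup.sel, symmetric]
  then show "lact TC (dup_mult l r) (dup_mult l r) (2 * n + 1) (Dup a \<beta>) (odd_transpose TC TB dsnd n y)
      = odd_transpose TC TB dsnd n (lact TB (*) (*) (2 * n + 1) \<beta> y)"
    and "ract TC (dup_mult l r) (dup_mult l r) (2 * n + 1) (odd_transpose TC TB dsnd n y) (Dup a \<beta>)
      = odd_transpose TC TB dsnd n (ract TB (*) (*) (2 * n + 1) y \<beta>)"
    by this+
qed

text \<open>
  The second factor is a retract of the duplication: \<open>dsnd\<close> is a homomorphism, and
  \<open>\<beta> \<mapsto> Dup 0 \<beta>\<close> is a homomorphism splitting it.
\<close>
lemma weakly_amenable_quotient_algebra:
  assumes wa: "weakly_amenable (2 * n + 1) (dup_scale sA sB) (dup_mult l r) TC"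
  shows "weakly_amenable (2 * n + 1) sB (*) TB"
  by (rule weakly_amenable_retract[OF TC TB n bounded_hom_dup_mult[OF A B act] bounded_hom_mult[OF B]
        bounded_hom_proj(2) _ bounded_hom_incl(2) _ _ wa])
    (simp_all add: dup_mult_def action_zero)

text \<open>
  The transposes of \<open>dfst\<close> and \<open>dsnd\<close> identify pairs \<open>(x, y)\<close> with elements of the dual of the
  duplication. By the preceding lemmas \<open>Dup a \<beta>\<close> acts on such a pair from the left by
  \<open>(a x + \<beta> x, \<beta> y + a x)\<close>, the last term being the mixed operation, and similarly from the right.
  So \<open>(a, \<beta>) \<mapsto> (D1A a + D1B \<beta>, D2A a)\<close> is a derivation once it satisfies the product rule on
  \<open>a b\<close>, \<open>a \<cdot> \<gamma>\<close>, \<open>\<beta> \<cdot> b\<close> and \<open>\<beta> \<gamma>\<close> separately in each component. In the first component these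
  are the derivation properties of \<open>D1A\<close> and \<open>D1B\<close> and the two equations for \<open>D1A\<close> in
  \<open>property_H\<close>; in the second component the remaining three equations, as nothing is contributed by
  \<open>\<beta> \<gamma>\<close>.
\<close>
lemma derivation_dup:
  assumes D1A: "derivation sA (*) (uscale TA) (lev TA (2 * n + 1))
      (lact TA (*) (*) (2 * n + 1)) (ract TA (*) (*) (2 * n + 1)) D1A"
    and D1B: "derivation sB (*) (uscale TA) (lev TA (2 * n + 1))
      (lact TA l r (2 * n + 1)) (ract TA l r (2 * n + 1)) D1B"
    and D2A: "bounded_linear_into sA (uscale TB) (lev TB (2 * n + 1)) D2A"
    and H: "\<And>a \<beta>. D1A (l \<beta> a) = ract TA (*) (*) (2 * n + 1) (D1B \<beta>) a + lact TA l r (2 * n + 1) \<beta> (D1A a)"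
      "\<And>a \<beta>. D1A (r a \<beta>) = lact TA (*) (*) (2 * n + 1) a (D1B \<beta>) + ract TA l r (2 * n + 1) (D1A a) \<beta>"
      "\<And>a \<beta>. D2A (l \<beta> a) = mixr_odd TA TB l r n (D1B \<beta>) a + lact TB (*) (*) (2 * n + 1) \<beta> (D2A a)"
      "\<And>a \<beta>. D2A (r a \<beta>) = mixl_odd TA TB l r n a (D1B \<beta>) + ract TB (*) (*) (2 * n + 1) (D2A a) \<beta>"
      "\<And>a b. D2A (a * b) = mixr_odd TA TB l r n (D1A a) b + mixl_odd TA TB l r n a (D1A b)"
  shows "derivation (dup_scale sA sB) (dup_mult l r) (uscale TC) (lev TC (2 * n + 1))
      (lact TC (dup_mult l r) (dup_mult l r) (2 * n + 1)) (ract TC (dup_mult l r) (dup_mult l r) (2 * n + 1))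
      (\<lambda>c. odd_transpose TC TA dfst n (D1A (dfst c) + D1B (dsnd c)) + odd_transpose TC TB dsnd n (D2A (dfst c)))"
    (is "derivation _ _ _ _ ?L ?R ?D")
proof -
  let ?F = "odd_transpose TC TA dfst n" and ?G = "odd_transpose TC TB dsnd n"
  have le: "2 * n + 1 \<le> N" using n by simp
  have linear: "bounded_linear_into sA (uscale TA) (lev TA (2 * n + 1)) D1A"
      "bounded_linear_into sB (uscale TA) (lev TA (2 * n + 1)) D1B"
    and mult: "\<And>a b. D1A (a * b) = ract TA (*) (*) (2 * n + 1) (D1A a) b + lact TA (*) (*) (2 * n + 1) a (D1A b)"
      "\<And>\<beta> \<gamma>. D1B (\<beta> * \<gamma>) = ract TA l r (2 * n + 1) (D1B \<beta>) \<gamma> + lact TA l r (2 * n + 1) \<beta> (D1B \<gamma>)"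
    using D1A D1B unfolding derivation_def by blast+
  note mem = bounded_linear_intoD(1)[OF linear(1)] bounded_linear_intoD(1)[OF linear(2)]
    bounded_linear_intoD(1)[OF D2A]
  note add = bounded_linear_intoD(2)[OF linear(1)] bounded_linear_intoD(2)[OF linear(2)]
    bounded_linear_intoD(2)[OF D2A]
  note closed = lev_closed(2)[OF TA le] lev_closed(2)[OF TB le] lev_closed(2)[OF TC le]
  have F_add: "?F (x + y) = ?F x + ?F y" if "x \<in> lev TA (2 * n + 1)" "y \<in> lev TA (2 * n + 1)" for x y
    using odd_transpose_add[OF TC TA bounded_hom_proj(1) n] that by simp
  have G_add: "?G (x + y) = ?G x + ?G y" if "x \<in> lev TB (2 * n + 1)" "y \<in> lev TB (2 * n + 1)" for x y
    using odd_transpose_add[OF TC TB bounded_hom_proj(2) n] that by simp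
  have FG_mem: "\<And>x. x \<in> lev TA (2 * n + 1) \<Longrightarrow> ?F x \<in> lev TC (2 * n + 1)"
      "\<And>y. y \<in> lev TB (2 * n + 1) \<Longrightarrow> ?G y \<in> lev TC (2 * n + 1)"
    using iterated_transpose_mem(2)[OF TC TA bounded_hom_proj(1) n]
      iterated_transpose_mem(2)[OF TC TB bounded_hom_proj(2) n] by simp_all
  note mult_dup = bounded_hom_dup_mult[OF A B act]
  have LR_add: "?L c (x + y) = ?L c x + ?L c y" "?R (x + y) c = ?R x c + ?R y c"
    if "x \<in> lev TC (2 * n + 1)" "y \<in> lev TC (2 * n + 1)" for c x y
    using odd_transpose_add[OF TC TC mult_dup(1) n] odd_transpose_add[OF TC TC mult_dup(2) n] that
    unfolding lact_odd ract_odd by simp_all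
  have act_mem:
      "\<And>a x. x \<in> lev TA (2 * n + 1) \<Longrightarrow> lact TA (*) (*) (2 * n + 1) a x \<in> lev TA (2 * n + 1)"
      "\<And>a x. x \<in> lev TA (2 * n + 1) \<Longrightarrow> ract TA (*) (*) (2 * n + 1) x a \<in> lev TA (2 * n + 1)"
      "\<And>\<beta> x. x \<in> lev TA (2 * n + 1) \<Longrightarrow> lact TA l r (2 * n + 1) \<beta> x \<in> lev TA (2 * n + 1)"
      "\<And>\<beta> x. x \<in> lev TA (2 * n + 1) \<Longrightarrow> ract TA l r (2 * n + 1) x \<beta> \<in> lev TA (2 * n + 1)"
      "\<And>\<beta> y. y \<in> lev TB (2 * n + 1) \<Longrightarrow> lact TB (*) (*) (2 * n + 1) \<beta> y \<in> lev TB (2 * n + 1)"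
      "\<And>\<beta> y. y \<in> lev TB (2 * n + 1) \<Longrightarrow> ract TB (*) (*) (2 * n + 1) y \<beta> \<in> lev TB (2 * n + 1)"
      "\<And>a x. x \<in> lev TA (2 * n + 1) \<Longrightarrow> mixl_odd TA TB l r n a x \<in> lev TB (2 * n + 1)"
      "\<And>a x. x \<in> lev TA (2 * n + 1) \<Longrightarrow> mixr_odd TA TB l r n x a \<in> lev TB (2 * n + 1)"
    unfolding lact_odd ract_odd mixl_odd_eq_transpose mixr_odd_eq_transpose
    using iterated_transpose_mem(2)[OF TA TA bounded_hom_mult(1)[OF A] n]
      iterated_transpose_mem(2)[OF TA TA bounded_hom_mult(2)[OF A] n]
      iterated_transpose_mem(2)[OF TA TA bounded_hom_action(1)[OF act] n]
      iterated_transpose_mem(2)[OF TA TA bounded_hom_action(2)[OF act] n]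
      iterated_transpose_mem(2)[OF TB TB bounded_hom_mult(1)[OF B] n]
      iterated_transpose_mem(2)[OF TB TB bounded_hom_mult(2)[OF B] n]
      iterated_transpose_mem(2)[OF TB TA bounded_hom_action(3)[OF act] n]
      iterated_transpose_mem(2)[OF TB TA bounded_hom_action(4)[OF act] n]
    by simp_all
  show ?thesis
    unfolding derivation_def
  proof (intro conjI allI)
    show "bounded_linear_into (dup_scale sA sB) (uscale TC) (lev TC (2 * n + 1)) ?D"
    proof (rule bounded_linear_into_add)
      show "bounded_linear_into (dup_scale sA sB) (uscale TC) (lev TC (2 * n + 1))
          (\<lambda>c. ?F (D1A (dfst c) + D1B (dsnd c)))"
        by (rule bounded_linear_into_bounded_map_on[OF tower_normed_space[OF TA] tower_normed_space[OF TC]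
              bounded_map_on_iterated_transpose(2)[OF TC TA bounded_hom_proj(1) n]
              bounded_linear_into_add[OF bounded_linear_into_comp[OF bounded_hom_proj(1) linear(1)]
                bounded_linear_into_comp[OF bounded_hom_proj(2) linear(2)] closed(1)]])
      show "bounded_linear_into (dup_scale sA sB) (uscale TC) (lev TC (2 * n + 1))
          (\<lambda>c. ?G (D2A (dfst c)))"
        by (rule bounded_linear_into_bounded_map_on[OF tower_normed_space[OF TB] tower_normed_space[OF TC]
              bounded_map_on_iterated_transpose(2)[OF TC TB bounded_hom_proj(2) n]
              bounded_linear_into_comp[OF bounded_hom_proj(1) D2A]])
    qed (rule closed(3))
    fix c d :: "('a, 'b) dup"
    obtain a \<beta> b \<gamma> where c: "c = Dup a \<beta>" and d: "d = Dup b \<gamma>"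
      by (cases c, cases d)
    note simps = F_add G_add LR_add FG_mem mem closed act_mem
      dup_action_odd_transpose_dfst dup_action_odd_transpose_dsnd
    have L: "?L c (?D d) = ?F (lact TA (*) (*) (2 * n + 1) a (D1A b)) + ?F (lact TA l r (2 * n + 1) \<beta> (D1A b))
        + ?F (lact TA (*) (*) (2 * n + 1) a (D1B \<gamma>)) + ?F (lact TA l r (2 * n + 1) \<beta> (D1B \<gamma>))
        + ?G (mixl_odd TA TB l r n a (D1A b)) + ?G (mixl_odd TA TB l r n a (D1B \<gamma>))
        + ?G (lact TB (*) (*) (2 * n + 1) \<beta> (D2A b))"
      by (simp only: c d dup.sel simps) (simp only: ac_simps)
    have R: "?R (?D c) d = ?F (ract TA (*) (*) (2 * n + 1) (D1A a) b) + ?F (ract TA l r (2 * n + 1) (D1A a) \<gamma>)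
        + ?F (ract TA (*) (*) (2 * n + 1) (D1B \<beta>) b) + ?F (ract TA l r (2 * n + 1) (D1B \<beta>) \<gamma>)
        + ?G (mixr_odd TA TB l r n (D1A a) b) + ?G (mixr_odd TA TB l r n (D1B \<beta>) b)
        + ?G (ract TB (*) (*) (2 * n + 1) (D2A a) \<gamma>)"
      by (simp only: c d dup.sel simps) (simp only: ac_simps)
    show "?D (dup_mult l r c d) = ?R (?D c) d + ?L c (?D d)"
      unfolding L R
      by (simp only: c d dup_mult_def dup.sel add mult H simps) (simp only: ac_simps)
  qed
qed

text \<open>
  The first factor need not be a retract of the duplication, as \<open>dfst\<close> is not multiplicative in general.
  Property \<open>property_H\<close> makes up for this: it lets a derivation of the first factor be extended to
  the duplication. The extension is inner, and the inclusion \<open>a \<mapsto> Dup a 0\<close>, which is a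
  homomorphism, pulls it back to the given derivation.
\<close>
lemma weakly_amenable_ideal_algebra:
  assumes wa: "weakly_amenable (2 * n + 1) (dup_scale sA sB) (dup_mult l r) TC"
    and H: "property_H n sA sB l r TA TB"
  shows "weakly_amenable (2 * n + 1) sA (*) TA"
  unfolding weakly_amenable_def
proof (intro allI impI)
  fix D1A
  assume D1A: "derivation sA (*) (uscale TA) (lev TA (2 * n + 1))
      (lact TA (*) (*) (2 * n + 1)) (ract TA (*) (*) (2 * n + 1)) D1A"
  obtain D1B D2A where D1B: "derivation sB (*) (uscale TA) (lev TA (2 * n + 1))
      (lact TA l r (2 * n + 1)) (ract TA l r (2 * n + 1)) D1B"
    and D2A: "bounded_linear_into sA (uscale TB) (lev TB (2 * n + 1)) D2A"
    and eqs: "\<And>a \<beta>. D1A (l \<beta> a) = ract TA (*) (*) (2 * n + 1) (D1B \<beta>) a + lact TA l r (2 * n + 1) \<beta> (D1A a)"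
      "\<And>a \<beta>. D1A (r a \<beta>) = lact TA (*) (*) (2 * n + 1) a (D1B \<beta>) + ract TA l r (2 * n + 1) (D1A a) \<beta>"
      "\<And>a \<beta>. D2A (l \<beta> a) = mixr_odd TA TB l r n (D1B \<beta>) a + lact TB (*) (*) (2 * n + 1) \<beta> (D2A a)"
      "\<And>a \<beta>. D2A (r a \<beta>) = mixl_odd TA TB l r n a (D1B \<beta>) + ract TB (*) (*) (2 * n + 1) (D2A a) \<beta>"
      "\<And>a b. D2A (a * b) = mixr_odd TA TB l r n (D1A a) b + mixl_odd TA TB l r n a (D1A b)"
    using H[unfolded property_H_def Let_def, rule_format, OF D1A] by blast
  define D where "D c = odd_transpose TC TA dfst n (D1A (dfst c) + D1B (dsnd c))
      + odd_transpose TC TB dsnd n (D2A (dfst c))" for c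
  have "inner_derivation (lev TC (2 * n + 1)) (lact TC (dup_mult l r) (dup_mult l r) (2 * n + 1))
      (ract TC (dup_mult l r) (dup_mult l r) (2 * n + 1)) D"
    using wa derivation_dup[OF D1A D1B D2A eqs] unfolding weakly_amenable_def D_def by blast
  moreover have "Dup (a * b) 0 = dup_mult l r (Dup a 0) (Dup b 0)" for a b
    by (simp add: dup_mult_def action_zero)
  ultimately have "inner_derivation (lev TA (2 * n + 1)) (lact TA (*) (*) (2 * n + 1)) (ract TA (*) (*) (2 * n + 1))
      (\<lambda>a. odd_transpose TA TC (\<lambda>a. Dup a 0) n (D (Dup a 0)))"
    by (intro inner_derivation_pullback[OF TA TC n bounded_hom_mult[OF A] bounded_hom_dup_mult[OF A B act]
        bounded_hom_incl(1)])
  moreover have "odd_transpose TA TC (\<lambda>a. Dup a 0) n (D (Dup a 0)) = D1A a" for a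
  proof -
    let ?I = "odd_transpose TA TC (\<lambda>a. Dup a 0) n"
    have linear: "bounded_linear_into sA (uscale TA) (lev TA (2 * n + 1)) D1A"
        "bounded_linear_into sB (uscale TA) (lev TA (2 * n + 1)) D1B"
      using D1A D1B unfolding derivation_def by blast+
    have mem: "D1A a \<in> lev TA (Suc (2 * n))" "D2A a \<in> lev TB (Suc (2 * n))"
      using bounded_linear_intoD(1)[OF linear(1)] bounded_linear_intoD(1)[OF D2A] by simp_all
    note hom = bounded_linear_into_comp[OF bounded_hom_incl(1)]
    have "?I (D (Dup a 0)) = ?I (odd_transpose TC TA dfst n (D1A a)) + ?I (odd_transpose TC TB dsnd n (D2A a))"
      using iterated_transpose_mem(2)[OF TC TA bounded_hom_proj(1) n mem(1)]
        iterated_transpose_mem(2)[OF TC TB bounded_hom_proj(2) n mem(2)]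
        odd_transpose_add[OF TA TC bounded_hom_incl(1) n]
      by (simp add: D_def bounded_linear_intoD(3)[OF linear(2)])
    \<comment> \<open>\<open>dfst\<close> and \<open>dsnd\<close> restrict to the identity and to zero on the image of the inclusion.\<close>
    also have "?I (odd_transpose TC TA dfst n (D1A a)) = D1A a"
      using odd_transpose_comp[OF TA TC TA bounded_hom_incl(1) bounded_hom_proj(1)
          hom[OF bounded_hom_proj(1)] refl n mem(1)]
        odd_transpose_id[OF TA hom[OF bounded_hom_proj(1)] _ n mem(1)]
      by simp
    also have "?I (odd_transpose TC TB dsnd n (D2A a)) = 0"
      using odd_transpose_comp[OF TA TC TB bounded_hom_incl(1) bounded_hom_proj(2)
          hom[OF bounded_hom_proj(2)] refl n mem(2)]
        odd_transpose_zero[OF TA TB hom[OF bounded_hom_proj(2)] _ n mem(2)]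
      by simp
    finally show ?thesis by simp
  qed
  ultimately show "inner_derivation (lev TA (2 * n + 1)) (lact TA (*) (*) (2 * n + 1))
      (ract TA (*) (*) (2 * n + 1)) D1A"
    by simp
qed

end

theorem theorem5p3:
  fixes sA :: "'k::real_normed_field \<Rightarrow> 'a::{real_normed_algebra,banach} \<Rightarrow> 'a"
    and sB :: "'k \<Rightarrow> 'b::{real_normed_algebra,banach} \<Rightarrow> 'b"
    and l :: "'b \<Rightarrow> 'a \<Rightarrow> 'a" and r :: "'a \<Rightarrow> 'b \<Rightarrow> 'a"
    and n :: nat
    and TA :: "('k, 'a, 'u::real_normed_vector) tower"
    and TB :: "('k, 'b, 'v::real_normed_vector) tower"
    and TC :: "('k, ('a, 'b) dup, 'w::real_normed_vector) tower"
  assumes "banach_algebra_over sA"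
    and "banach_algebra_over sB"
    and "banach_bimodule_over sB sA l r"
    and "compatible_actions l r"
    and "dual_tower (2 * n + 1) sA TA"
    and "dual_tower (2 * n + 1) sB TB"
    and "dual_tower (2 * n + 1) (dup_scale sA sB) TC"
    and "weakly_amenable (2 * n + 1) (dup_scale sA sB) (dup_mult l r) TC"
  shows "weakly_amenable (2 * n + 1) sB (*) TB \<and>
    (property_H n sA sB l r TA TB \<longrightarrow> weakly_amenable (2 * n + 1) sA (*) TA)"
proof (intro conjI impI)
  have "2 * n < 2 * n + 1" by simp
  note duplication = assms(1-3,5-7) this
  show "weakly_amenable (2 * n + 1) sB (*) TB"
    by (rule weakly_amenable_quotient_algebra[OF duplication assms(8)])
  assume "property_H n sA sB l r TA TB"
  then show "weakly_amenable (2 * n + 1) sA (*) TA"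
    by (rule weakly_amenable_ideal_algebra[OF duplication assms(8)])
qed

end
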